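(* Let $G$ be a 2-connected plane graph, let $\alpha$ be an out-degree function on $V(G)$, and let $D$ and $D'$ be two strongly connected $\alpha$-orientations of $G$. Then $D\preccurlyeq D'$ (that is, $D$ can be obtained from $D'$ by a sequence of flips) if and only if for every face $f\in\mathcal{F}(G)$, $$z_{D'-D}(f)\geq 0.$$ Moreover, if $D\preccurlyeq D'$, then the flip-distance from $D'$ to $D$ is $$d(D',D)=\sum_{f\in\mathcal{F}(G)} z_{D'-D}(f).$$
   Context: A plane graph is a (finite) planar graph embedded on the plane. $\mathcal{F}(G)$ is the set of all faces of $G$ (including the outer face $f_{\rm out}$). An orientation $D$ of $G$ assigns a direction to each edge; given $\alpha:V(G)\to\mathbb{Z}_{\ge 0}$, $D$ is an $\alpha$-orientation if every vertex $v$ has out-degree $d_D^+(v)=\alpha(v)$. A directed simple cycle $C$ is counterclockwise (ccw) if the interior region of $C$ lies to the left of $C$, and clockwise (cw) if it lies to the right. In general a flip is the reorientation of a ccw essential cycle from ccw to cw; for strongly connected $\alpha$-orientations of 2-connected plane graphs the essential cycles are exactly the inner facial cycles (boundaries of inner faces, which are simple cycles), so here a flip means: choose an inner face whose boundary cycle is directed ccw in the current orientation, and reverse all edges of that boundary cycle (making it cw). A flip sequence is a finite (possibly empty) sequence of flips applied successively. $D\preccurlyeq D'$ means that $D$ can be obtained from $D'$ by a flip sequence; in that case $d(D',D)$ is the minimum number of flips in a flip sequence transforming $D'$ into $D$. $D'-D$ denotes the directed graph obtained from $D'$ by removing those edges which have the same direction in $D$ (so it consists of the edges oriented differently in $D$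 and $D'$, directed as in $D'$). It is oriented Eulerian: at every vertex in-degree equals out-degree. For a directed edge $e$, a face incident with $e$ is said to be left of $e$ if it lies to the left side of $e$ when following the direction of $e$. For an oriented Eulerian subgraph $F$ of an $\alpha$-orientation of $G$, the $F$-potential $z_F:\mathcal{F}(G)\to\mathbb{Z}$ is the (well-defined, unique) function with: (1) $z_F(f_{\rm out})=0$; (2) if $f_1$ and $f_2$ are two faces sharing a common edge $e$, then $z_F(f_2)=z_F(f_1)+1$ if $e\in F$ and $f_2$ is left of $e$; $z_F(f_2)=z_F(f_1)-1$ if $e\in F$ and $f_1$ is left of $e$; and $z_F(f_2)=z_F(f_1)$ otherwise. *)

theory Defs
  imports "HOL-Complex_Analysis.Complex_Analysis" "Graph_Theory.Graph_Theory"
begin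

text \<open>
  A graph drawn in the plane, which is identified with the complex numbers: vertices are points
  and every edge label comes with a curve.  The direction in which a curve is parametrised carries
  no meaning.  Edges are labels, so parallel edges are allowed; loops are not.
\<close>

record 'e plane_drawing =
  vertices :: "complex set"
  edges :: "'e set"
  curve :: "'e \<Rightarrow> real \<Rightarrow> complex"

definition plane_graph :: "'e plane_drawing \<Rightarrow> bool" where
  "plane_graph G \<longleftrightarrow>
     finite (vertices G) \<and> finite (edges G) \<and>
     (\<forall>e\<in>edges G. arc (curve G e) \<and>
        path_image (curve G e) \<inter> vertices G =
          {pathstart (curve G e), pathfinish (curve G e)}) \<and>
     (\<forall>e\<in>edges G. \<forall>e'\<in>edges G. e \<noteq> e' \<longrightarrow>
        path_image (curve G e) \<inter> path_image (curve G e') \<subseteq> vertices G)"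

subsection \<open>Faces\<close>

definition faces :: "'e plane_drawing \<Rightarrow> complex set set" where
  "faces G = components (- (vertices G \<union> (\<Union>e\<in>edges G. path_image (curve G e))))"

definition outer_face :: "'e plane_drawing \<Rightarrow> complex set" where
  "outer_face G = (THE f. f \<in> faces G \<and> \<not> bounded f)"

definition incident :: "'e plane_drawing \<Rightarrow> complex set \<Rightarrow> 'e \<Rightarrow> bool" where
  "incident G f e \<longleftrightarrow> path_image (curve G e) \<subseteq> frontier f"

subsection \<open>Directed edges and orientations\<close>

text \<open>
  A directed edge is an edge together with a flag: \<^term>\<open>(e, True)\<close> is traversed along
  \<^term>\<open>curve G e\<close> and \<^term>\<open>(e, False)\<close> against it.
\<close>

type_synonym 'e dart = "'e \<times> bool"

definition dart_curve :: "'e plane_drawing \<Rightarrow> 'e dart \<Rightarrow> real \<Rightarrow> complex" where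
  "dart_curve G d = (if snd d then curve G (fst d) else reversepath (curve G (fst d)))"

definition rev_dart :: "'e dart \<Rightarrow> 'e dart" where
  "rev_dart d = (fst d, \<not> snd d)"

definition digraph_of :: "'e plane_drawing \<Rightarrow> 'e dart set \<Rightarrow> (complex, 'e dart) pre_digraph" where
  "digraph_of G D =
     \<lparr>verts = vertices G, arcs = D,
      tail = (\<lambda>d. pathstart (dart_curve G d)), head = (\<lambda>d. pathfinish (dart_curve G d))\<rparr>"

text \<open>
  An orientation is the set of directed edges it selects, so for orientations \<open>D'\<close> and \<open>D\<close> the set
  difference \<open>D' - D\<close> consists of the edges on which they differ, directed as in \<open>D'\<close>.
\<close>

definition orientation :: "'e plane_drawing \<Rightarrow> 'e dart set \<Rightarrow> bool" where
  "orientation G D \<longleftrightarrow>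
     D \<subseteq> edges G \<times> UNIV \<and> (\<forall>e\<in>edges G. (e, True) \<in> D \<longleftrightarrow> (e, False) \<notin> D)"

definition alpha_orientation ::
  "'e plane_drawing \<Rightarrow> (complex \<Rightarrow> nat) \<Rightarrow> 'e dart set \<Rightarrow> bool" where
  "alpha_orientation G \<alpha> D \<longleftrightarrow>
     orientation G D \<and> (\<forall>v\<in>vertices G. out_degree (digraph_of G D) v = \<alpha> v)"

text \<open>The undirected graph, in the library's model of graphs as symmetric digraphs.\<close>

definition graph_of :: "'e plane_drawing \<Rightarrow> (complex, 'e dart) pre_digraph" where
  "graph_of G = digraph_of G (edges G \<times> UNIV)"

definition two_connected :: "'e plane_drawing \<Rightarrow> bool" where
  "two_connected G \<longleftrightarrow>
     card (vertices G) > 2 \<and> Digraph_Component.connected (graph_of G) \<and>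
     (\<forall>v\<in>vertices G. Digraph_Component.connected (pre_digraph.del_vert (graph_of G) v))"

subsection \<open>Left and right\<close>

definition ccw :: "(real \<Rightarrow> complex) \<Rightarrow> bool" where
  "ccw c \<longleftrightarrow> simple_path c \<and> pathfinish c = pathstart c \<and>
     (\<forall>z\<in>inside (path_image c). winding_number c z = 1)"

definition left_region :: "(real \<Rightarrow> complex) \<Rightarrow> complex set" where
  "left_region c = (if ccw c then inside (path_image c) else outside (path_image c))"

text \<open>
  Edges are arbitrary arcs without tangents, so the side on which a face lies is defined by closing
  the directed edge up to a simple closed curve: near an inner point of the edge, the left side of
  the edge and that of the closed curve agree, whichever closing arc \<open>p\<close> is used.  That arc need
  not belong to the graph.
\<close>

definition left_of :: "'e plane_drawing \<Rightarrow> complex set \<Rightarrow> 'e dart \<Rightarrow> bool" where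
  "left_of G f d \<longleftrightarrow> incident G f (fst d) \<and>
     (\<exists>p t. pathstart p = pathfinish (dart_curve G d) \<and>
            pathfinish p = pathstart (dart_curve G d) \<and>
            simple_path (dart_curve G d +++ p) \<and> t \<in> {0<..<1} \<and>
            dart_curve G d t \<in> closure (f \<inter> left_region (dart_curve G d +++ p)))"

subsection \<open>Potentials\<close>

definition is_potential ::
  "'e plane_drawing \<Rightarrow> 'e dart set \<Rightarrow> (complex set \<Rightarrow> int) \<Rightarrow> bool" where
  "is_potential G F z \<longleftrightarrow>
     z (outer_face G) = 0 \<and>
     (\<forall>f1\<in>faces G. \<forall>f2\<in>faces G. \<forall>e\<in>edges G.
        f1 \<noteq> f2 \<and> incident G f1 e \<and> incident G f2 e \<longrightarrow>
        z f2 = (if \<exists>d\<in>F. fst d = e \<and> left_of G f2 d then z f1 + 1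
                else if \<exists>d\<in>F. fst d = e \<and> left_of G f1 d then z f1 - 1
                else z f1))"

text \<open>The value 0 off the faces is a convention that makes the function unique.\<close>

definition potential :: "'e plane_drawing \<Rightarrow> 'e dart set \<Rightarrow> complex set \<Rightarrow> int" where
  "potential G F = (THE z. is_potential G F z \<and> (\<forall>f. f \<notin> faces G \<longrightarrow> z f = 0))"

subsection \<open>Flips\<close>

fun walk_curve :: "'e plane_drawing \<Rightarrow> 'e dart list \<Rightarrow> real \<Rightarrow> complex" where
  "walk_curve G [] = (\<lambda>_. 0)"
| "walk_curve G [d] = dart_curve G d"
| "walk_curve G (d # d' # ds) = dart_curve G d +++ walk_curve G (d' # ds)"

definition flip :: "'e plane_drawing \<Rightarrow> 'e dart set \<Rightarrow> 'e dart set \<Rightarrow> bool" where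
  "flip G D1 D2 \<longleftrightarrow>
     (\<exists>f\<in>faces G - {outer_face G}. \<exists>C.
        pre_digraph.cycle (digraph_of G D1) C \<and>
        path_image (walk_curve G C) = frontier f \<and> ccw (walk_curve G C) \<and>
        D2 = (D1 - set C) \<union> rev_dart ` set C)"

text \<open>\<open>flip_le G D D'\<close>: the orientation \<open>D\<close> can be obtained from \<open>D'\<close> by a flip sequence.\<close>

definition flip_le :: "'e plane_drawing \<Rightarrow> 'e dart set \<Rightarrow> 'e dart set \<Rightarrow> bool" where
  "flip_le G D D' \<longleftrightarrow> (flip G)\<^sup>*\<^sup>* D' D"

definition flip_distance :: "'e plane_drawing \<Rightarrow> 'e dart set \<Rightarrow> 'e dart set \<Rightarrow> nat" where
  "flip_distance G D' D = (LEAST n. (flip G ^^ n) D' D)"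

end

theory Submission
  imports Defs
begin

text \<open>
  A function on the faces is the potential of \<open>D' - D\<close> iff it vanishes on the outer face and, across
  every directed edge \<open>d\<close>, its value left of \<open>d\<close> minus its value right of \<open>d\<close> is \<open>[d \<in> D'] - [d \<in> D]\<close>.
  Such a function is unique because the dual graph is connected, and it exists because a sum of
  winding numbers over a circulation is an integer, constant on faces, and jumps by the flow value
  across an edge.  Flipping an inner face \<open>f\<close> lowers the potential by 1 at \<open>f\<close> and changes nothing
  else, so a flip sequence from \<open>D'\<close> to \<open>D\<close> forces the potential to be non-negative, and its length is
  the total potential.

  Conversely, if \<open>D'\<close> is strongly connected, every edge lies on a closed directed walk, whose winding
  function does not decrease from right to left across any edge of \<open>D'\<close>; summing over all edges gives
  a height that strictly increases from right to left, i.e. the dual is acyclic.  Along a dual edge a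
  non-negative potential does not decrease either, so a highest face among those of positive potential
  has itself on the left of all its boundary edges: it can be flipped.  The height survives a flip
  after making the flipped face the lowest one.

  The topological input is that every edge has exactly two sides, and that every face is bounded by a
  cycle.  Both follow from the Jordan curve theorem and Janiszewski's theorem.
\<close>

hide_const (open) Digraph_Component.connected

section \<open>Sides of simple closed curves\<close>

text \<open>Edges are bare arcs without tangents, so left and right cannot be read off an edge
  itself. Statements about sides are reduced to winding numbers of a Jordan curve through the edge:
  whatever its sense of rotation, the winding number rises by 1 from its right to its left side. Two
  such curves, or a curve and a weighted sum of edges, are compared near an inner point of the edge,
  where all other contributions are continuous; an integer that varies by less than 1 does not vary.
  Janiszewski's theorem enters in this form: if two compact sets have a connected intersection and
  neither separates two given points, then their union does not separate them. The connected
  intersection is an ear of a cycle in one application and the rest of a cycle through an edge in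
  the other. The induction on flips carries the height of the faces instead of strong connectivity,
  because the height passes to the next orientation by changing a single value.\<close>

lemma components_eqI: "S \<in> components U \<Longrightarrow> S' \<in> components U \<Longrightarrow> x \<in> S \<Longrightarrow> x \<in> S' \<Longrightarrow> S = S'"
  using components_nonoverlap[of S U S'] by blast

lemma component_closed_under_connected_component:
  assumes "S \<in> components U" "x \<in> S" "connected_component U x y"
  shows "y \<in> S"
  using assms by (auto simp: components_iff intro: connected_component_trans)

text \<open>Adding to \<open>S'\<close> the points of \<open>B\<close> outside
  \<open>A \<union> P\<close> keeps it connected, as they are limit points of \<open>S'\<close>. If
  \<open>A \<union> P\<close> cuts \<open>x\<close> off from \<open>y\<close>, it therefore cuts
  \<open>x\<close> off from all these points, and the component of \<open>x\<close> avoids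
  \<open>A \<union> B\<close>.\<close>

lemma component_subset_of_disconnected:
  fixes A B P S S' :: "complex set"
  assumes S: "S \<in> components (- (A \<union> B))" and "x \<in> S" "x \<notin> P"
    and S': "connected S'" "S' \<inter> (A \<union> P) = {}" "B \<subseteq> closure S'" "y \<in> S'"
    and not: "\<not> connected_component (- (A \<union> P)) x y"
  shows "connected_component_set (- (A \<union> P)) x \<subseteq> S"
proof -
  let ?T = "connected_component_set (- (A \<union> P)) x"
  let ?W = "S' \<union> (B - (A \<union> P))"
  have "connected ?W"
    using S' closure_subset[of S'] by (intro connected_intermediate_closure[of S' ?W]) auto
  moreover have "?W \<subseteq> - (A \<union> P)" using S' by auto
  ultimately have W: "?W \<subseteq> connected_component_set (- (A \<union> P)) y"
    using S' by (intro connected_component_maximal) auto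
  have "?T \<inter> ?W = {}"
    using W not by (auto dest: connected_component_sym connected_component_trans)
  then have "?T \<subseteq> - (A \<union> B)"
    using connected_component_subset[of "- (A \<union> P)" x] by blast
  moreover have "x \<in> - (A \<union> P)"
    using assms in_components_subset[OF S] by auto
  then have "x \<in> ?T" by simp
  ultimately show ?thesis
    using components_maximal[OF S connected_connected_component, of "- (A \<union> P)" x] \<open>x \<in> S\<close> by blast
qed

text \<open>In the application, \<open>A\<close> and \<open>B\<close> are the two arcs of a cycle
  between the ends of an ear \<open>P\<close>, and \<open>S'\<close> is the side without the ear. If
  both conclusions failed, neither \<open>A \<union> P\<close> nor \<open>B \<union> P\<close> would
  separate \<open>x\<close> from a point of \<open>S'\<close>. They meet in the connected set
  \<open>P\<close>, so by Janiszewski their union would not separate either, yet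
  \<open>A \<union> B\<close> does.\<close>

lemma theta_component_subset:
  fixes A B P S S' :: "complex set"
  assumes "compact A" "compact B" "compact P" "connected P" "A \<inter> B \<subseteq> P"
    and S: "S \<in> components (- (A \<union> B))" and "x \<in> S" "x \<notin> P"
    and S': "S' \<in> components (- (A \<union> B))" "S' \<inter> P = {}" "A \<union> B \<subseteq> closure S'"
    and "S \<noteq> S'"
  shows "connected_component_set (- (A \<union> P)) x \<subseteq> S \<or> connected_component_set (- (B \<union> P)) x \<subseteq> S"
proof (rule ccontr)
  assume c: "\<not> ?thesis"
  obtain y where y: "y \<in> S'" using S' in_components_nonempty by blast
  have cS': "connected S'" "S' \<inter> (A \<union> B) = {}" 
    using in_components_connected[OF S'(1)] in_components_subset[OF S'(1)] by auto
  have "connected_component (- (A \<union> P)) x y"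
    using component_subset_of_disconnected[of S A B x P S' y] c S' cS' y assms by blast
  moreover have "connected_component (- (B \<union> P)) x y"
    using component_subset_of_disconnected[of S B A x P S' y] c S' cS' y assms
    by (auto simp: Un_commute)
  moreover have "(A \<union> P) \<inter> (B \<union> P) = P" using assms by blast
  ultimately have "connected_component (- ((A \<union> P) \<union> (B \<union> P))) x y"
    using assms by (intro Janiszewski[of "A \<union> P" "B \<union> P"]) (simp_all add: compact_Un compact_imp_closed)
  then have "connected_component (- (A \<union> B)) x y"
    by (rule connected_component_of_subset) auto
  then have "y \<in> S"
    using component_closed_under_connected_component[OF S \<open>x \<in> S\<close>] by simp
  then show False
    using y components_eqI[OF S S'(1)] \<open>S \<noteq> S'\<close> by simp
qed

section \<open>The two sides of a Jordan curve\<close>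

context
  fixes c :: "real \<Rightarrow> complex"
  assumes c: "simple_path c" "pathfinish c = pathstart c"
begin

lemma components_Compl_Jordan: "components (- path_image c) = {inside (path_image c), outside (path_image c)}"
proof -
  note J = Jordan_inside_outside[OF c]
  have "inside (path_image c) \<in> components (- path_image c)" "outside (path_image c) \<in> components (- path_image c)"
    using J inside_in_components[of "path_image c"] outside_in_components[of "path_image c"] by auto
  moreover have "S = inside (path_image c) \<or> S = outside (path_image c)"
    if S: "S \<in> components (- path_image c)" for S
  proof -
    obtain x where x: "x \<in> S" "x \<in> - path_image c"
      using in_components_nonempty[OF S] in_components_subset[OF S] by blast
    from x show ?thesis
      using calculation J components_eqI[OF S, where x = x] by (metis UnE)
  qed
  ultimately show ?thesis by auto
qed

lemma left_region_cases:
  obtains "left_region c = inside (path_image c)" "- path_image c - left_region c = outside (path_image c)"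
  | "left_region c = outside (path_image c)" "- path_image c - left_region c = inside (path_image c)"
proof -
  have "- path_image c - inside (path_image c) = outside (path_image c)"
    "- path_image c - outside (path_image c) = inside (path_image c)"
    using Jordan_inside_outside[OF c] by blast+
  then show thesis using that unfolding left_region_def by (cases "ccw c") simp_all
qed

text \<open>A curve that is not \<open>ccw\<close> winds -1 times around its inside, and its left
  side is the outside; the offset -1 covers this case. Hence the step from right to left is +1 for
  both senses of rotation.\<close>

lemma winding_number_left_region:
  assumes "z \<notin> path_image c"
  shows "winding_number c z = of_bool (z \<in> left_region c) + (if ccw c then 0 else -1)"
proof -
  note J = Jordan_inside_outside[OF c]
  have z: "z \<in> inside (path_image c) \<longleftrightarrow> z \<notin> outside (path_image c)"
    using J assms by (metis Compl_iff IntI UnE emptyE)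
  have o: "winding_number c z = 0" if "z \<in> outside (path_image c)"
    using winding_number_zero_in_outside c that simple_path_imp_path by blast
  show ?thesis
  proof (cases "ccw c")
    case True
    then show ?thesis using o z by (auto simp: ccw_def left_region_def)
  next
    case False
    then have "winding_number c z = -1" if "z \<in> inside (path_image c)"
      using simple_closed_path_winding_number_inside[OF c(1)] c that unfolding ccw_def by metis
    then show ?thesis using False z o by (auto simp: left_region_def)
  qed
qed

lemma sides_in_components:
  "left_region c \<in> components (- path_image c)"
  "- path_image c - left_region c \<in> components (- path_image c)"
proof -
  show "left_region c \<in> components (- path_image c)"
    by (rule left_region_cases) (simp_all only: components_Compl_Jordan insert_iff simp_thms)
  show "- path_image c - left_region c \<in> components (- path_image c)"
    by (rule left_region_cases) (simp_all only: components_Compl_Jordan insert_iff simp_thms)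
qed

lemma frontier_component_Jordan:
  "S \<in> components (- path_image c) \<Longrightarrow> frontier S = path_image c"
  using Jordan_inside_outside[OF c] by (auto simp: components_Compl_Jordan)

lemma both_sides_near:
  assumes "x \<in> path_image c" "open U" "x \<in> U"
  shows "U \<inter> left_region c \<noteq> {}" "U \<inter> (- path_image c - left_region c) \<noteq> {}"
proof -
  have "x \<in> closure S" if "S \<in> components (- path_image c)" for S
    using frontier_component_Jordan[OF that] assms(1) by (auto simp: frontier_def)
  then show "U \<inter> left_region c \<noteq> {}" "U \<inter> (- path_image c - left_region c) \<noteq> {}"
    using sides_in_components assms(2,3) open_Int_closure_eq_empty[OF assms(2)] by blast+
qed

lemma components_Compl_Jordan_obtain:
  assumes "S \<in> components (- path_image c)"
  obtains S' where "S' \<in> components (- path_image c)" "S' \<noteq> S" "S' \<inter> S = {}" "- path_image c = S \<union> S'"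
proof -
  note J = Jordan_inside_outside[OF c]
  have "inside (path_image c) \<noteq> outside (path_image c)" using J by auto
  consider "S = inside (path_image c)" | "S = outside (path_image c)"
    using assms components_Compl_Jordan by auto
  then show thesis
  proof cases
    case 1
    then show thesis
      using J components_Compl_Jordan \<open>inside (path_image c) \<noteq> outside (path_image c)\<close>
      by (intro that[of "outside (path_image c)"]) (simp_all add: Int_commute Un_commute)
  next
    case 2
    then show thesis
      using J components_Compl_Jordan \<open>inside (path_image c) \<noteq> outside (path_image c)\<close>
      by (intro that[of "inside (path_image c)"]) (simp_all add: Int_commute Un_commute)
  qed
qed

end

text \<open>Near \<open>x\<close> the difference of the two winding numbers is an integer and varies by less than 1.\<close>

lemma left_region_near:
  fixes J K :: "real \<Rightarrow> complex"
  assumes J: "simple_path J" "pathfinish J = pathstart J"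
    and K: "simple_path K" "pathfinish K = pathstart K"
    and U: "open U" "x \<in> U" "path_image J \<inter> U = path_image K \<inter> U" and x: "x \<in> path_image J"
    and h: "continuous (at x) h"
    and s: "s = 1 \<or> s = - 1"
    and eq: "\<And>z. z \<in> U - path_image J \<Longrightarrow> winding_number J z = of_int s * winding_number K z + h z"
  obtains r where "r > 0" "ball x r \<subseteq> U"
    "\<And>z. z \<in> ball x r - path_image J \<Longrightarrow> z \<in> left_region J \<longleftrightarrow> (if s = 1 then z \<in> left_region K else z \<notin> left_region K)"
proof -
  obtain r1 where r1: "r1 > 0" "\<And>z. dist z x < r1 \<Longrightarrow> dist (h z) (h x) < 1/2"
    using h unfolding continuous_at_eps_delta by (metis half_gt_zero_iff zero_less_one)
  obtain r2 where r2: "r2 > 0" "ball x r2 \<subseteq> U"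
    using U open_contains_ball by blast
  define r where "r = min r1 r2"
  have r: "r > 0" "ball x r \<subseteq> U" and hr: "\<And>z. z \<in> ball x r \<Longrightarrow> dist (h z) (h x) < 1/2"
    using r1 r2 by (auto simp: r_def dist_commute)
  define a :: "complex \<Rightarrow> int" where "a z = of_bool (z \<in> left_region J)" for z
  define b :: "complex \<Rightarrow> int" where "b z = of_bool (z \<in> left_region K)" for z
  \<comment> \<open>The orientation offsets of \<open>J\<close> and \<open>K\<close> from
    \<open>winding_number_left_region\<close>, collected so that \<open>h\<close> equals
    \<open>a - s * b - k\<close>.\<close>
  define k :: int where "k = s * (if ccw K then 0 else -1) - (if ccw J then 0 else -1)"
  have h_eq: "of_int (a z - s * b z - k) = h z" if "z \<in> ball x r - path_image J" for z
  proof -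
    have "z \<notin> path_image K" "z \<in> U - path_image J" using that U r by auto
    then show ?thesis
      using eq[of z] winding_number_left_region[OF J, of z] winding_number_left_region[OF K, of z]
      by (auto simp: a_def b_def k_def algebra_simps split: if_splits)
  qed
  have const: "a z - s * b z = a w - s * b w"
    if "z \<in> ball x r - path_image J" "w \<in> ball x r - path_image J" for z w
  proof -
    have "dist (h z) (h w) < 1"
      using hr[of z] hr[of w] that dist_triangle_half_r[of "h x" "h z" 1 "h w"] by (auto simp: dist_commute)
    moreover have "h z - h w = of_int ((a z - s * b z) - (a w - s * b w))"
      unfolding h_eq[OF that(1), symmetric] h_eq[OF that(2), symmetric] by simp
    ultimately have "norm (complex_of_int ((a z - s * b z) - (a w - s * b w))) < 1"
      by (simp only: dist_norm)
    then have "\<bar>(a z - s * b z) - (a w - s * b w)\<bar> < 1"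
      by (simp only: norm_of_int of_int_less_1_iff flip: of_int_abs)
    then show ?thesis by linarith
  qed
  \<comment> \<open>Both sides of \<open>J\<close> occur in the ball. Comparing a point with
    \<open>a = 1\<close> and a point with \<open>a = 0\<close> forces \<open>b\<close> to differ
    between them, which fixes the constant value of \<open>a - s * b\<close>: 0 for
    \<open>s = 1\<close> and 1 for \<open>s = - 1\<close>.\<close>
  obtain z1 where z1: "z1 \<in> ball x r" "z1 \<in> left_region J"
    using both_sides_near(1)[OF J x, of "ball x r"] r by auto
  obtain z2 where z2: "z2 \<in> ball x r" "z2 \<notin> path_image J" "z2 \<notin> left_region J"
    using both_sides_near(2)[OF J x, of "ball x r"] r by auto
  have z1J: "z1 \<notin> path_image J"
    using sides_in_components(1)[OF J] z1 in_components_subset by blast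
  show thesis
  proof
    fix z assume z: "z \<in> ball x r - path_image J"
    have "a z - s * b z = a z1 - s * b z1" "a z - s * b z = a z2 - s * b z2"
      using const[of z z1] const[of z z2] z z1 z2 z1J by auto
    then show "z \<in> left_region J \<longleftrightarrow> (if s = 1 then z \<in> left_region K else z \<notin> left_region K)"
      using s z1(2) z2(3) unfolding a_def b_def
      by (cases "z \<in> left_region J"; cases "z \<in> left_region K"; cases "z1 \<in> left_region K"; cases "z2 \<in> left_region K") auto
  qed (use r in auto)
qed

section \<open>Walks in a plane graph\<close>

locale plane_graph_drawing =
  fixes G :: "'e plane_drawing"
  assumes plane: "plane_graph G"
begin

section \<open>Darts and combinatorial walks\<close>

definition darts :: "'e dart set" where
  "darts = edges G \<times> UNIV"


abbreviation src :: "'e dart \<Rightarrow> complex" where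
  "src d \<equiv> pathstart (dart_curve G d)"

abbreviation tgt :: "'e dart \<Rightarrow> complex" where
  "tgt d \<equiv> pathfinish (dart_curve G d)"

abbreviation img :: "'e dart \<Rightarrow> complex set" where
  "img d \<equiv> path_image (curve G (fst d))"

primrec chain :: "complex \<Rightarrow> 'e dart list \<Rightarrow> complex \<Rightarrow> bool" where
  "chain u [] v \<longleftrightarrow> u = v"
| "chain u (d # ds) v \<longleftrightarrow> src d = u \<and> chain (tgt d) ds v"

text \<open>The sources together with \<open>v\<close> are all the vertices visited, so no vertex is
  repeated and the walk traces an arc unless it is empty.\<close>

definition ipath :: "complex \<Rightarrow> 'e dart list \<Rightarrow> complex \<Rightarrow> bool" where
  "ipath u xs v \<longleftrightarrow> set xs \<subseteq> darts \<and> chain u xs v \<and> distinct (map src xs) \<and> v \<notin> src ` set xs"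

text \<open>Distinctness of the edges excludes running along an edge and straight back.\<close>

definition cyc :: "'e dart list \<Rightarrow> bool" where
  "cyc xs \<longleftrightarrow> xs \<noteq> [] \<and> set xs \<subseteq> darts \<and> chain (src (hd xs)) xs (src (hd xs)) \<and>
     distinct (map src xs) \<and> distinct (map fst xs)"

lemma fst_rev_dart [simp]: "fst (rev_dart d) = fst d"
  by (simp add: rev_dart_def)

lemma rev_dart_rev_dart [simp]: "rev_dart (rev_dart d) = d"
  by (simp add: rev_dart_def)

lemma dart_curve_rev_dart [simp]: "dart_curve G (rev_dart d) = reversepath (dart_curve G d)"
  by (auto simp: dart_curve_def rev_dart_def)

lemma fst_eq_dart: "fst d = fst d' \<longleftrightarrow> d = d' \<or> d = rev_dart d'"
  by (cases d; cases d') (auto simp: rev_dart_def)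

lemma in_darts: "d \<in> darts \<longleftrightarrow> fst d \<in> edges G"
  by (cases d) (simp add: darts_def)

lemma Pair_in_darts [simp]: "(e, b) \<in> darts \<longleftrightarrow> e \<in> edges G"
  by (simp add: in_darts)

lemma rev_dart_in_darts [simp]: "rev_dart d \<in> darts \<longleftrightarrow> d \<in> darts"
  by (simp add: in_darts)

lemma path_image_dart_curve [simp]: "path_image (dart_curve G d) = img d"
  by (simp add: dart_curve_def)

lemma finite_vertices: "finite (vertices G)" and finite_edges: "finite (edges G)"
  using plane by (auto simp: plane_graph_def)

lemma arc_curve: "e \<in> edges G \<Longrightarrow> arc (curve G e)"
  using plane by (auto simp: plane_graph_def)

lemma arc_dart: "d \<in> darts \<Longrightarrow> arc (dart_curve G d)"
  using arc_curve by (auto simp: dart_curve_def arc_reversepath in_darts)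

lemma path_dart: "d \<in> darts \<Longrightarrow> path (dart_curve G d)"
  by (simp add: arc_dart arc_imp_path)

lemma img_Int_vertices: "d \<in> darts \<Longrightarrow> img d \<inter> vertices G = {src d, tgt d}"
  using plane by (cases d) (auto simp: plane_graph_def dart_curve_def)

lemma src_in_vertices: "d \<in> darts \<Longrightarrow> src d \<in> vertices G"
  and tgt_in_vertices: "d \<in> darts \<Longrightarrow> tgt d \<in> vertices G"
  using img_Int_vertices by blast+

lemma src_neq_tgt: "d \<in> darts \<Longrightarrow> src d \<noteq> tgt d"
  using arc_dart arc_distinct_ends by metis

lemma img_Int_img: "d \<in> darts \<Longrightarrow> d' \<in> darts \<Longrightarrow> fst d \<noteq> fst d' \<Longrightarrow> img d \<inter> img d' \<subseteq> vertices G"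
  using plane unfolding plane_graph_def in_darts by blast

lemma chain_append: "chain u (xs @ ys) v \<longleftrightarrow> (\<exists>w. chain u xs w \<and> chain w ys v)"
  by (induction xs arbitrary: u) auto

lemma chain_rev: "chain u xs v \<Longrightarrow> chain v (rev (map rev_dart xs)) u"
  by (induction xs arbitrary: u) (auto simp: chain_append)

text \<open>Both sides are the set of vertices visited by the walk. This turns facts about targets
  into facts about sources, in which \<open>ipath\<close> and \<open>cyc\<close> express
  distinctness.\<close>

lemma chain_tgt: "chain u xs v \<Longrightarrow> insert u (tgt ` set xs) = insert v (src ` set xs)"
proof (induction xs arbitrary: u)
  case (Cons d xs)
  then have "insert (tgt d) (tgt ` set xs) = insert v (src ` set xs)" by simp
  then show ?case using Cons.prems by (auto simp: insert_commute)
qed simp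

lemma chain_tl_tgt: "chain u (d # xs) u \<Longrightarrow> tgt ` set (d # xs) = src ` set (d # xs)"
  using chain_tgt[of "tgt d" xs u] by simp

text \<open>Loop erasure: if the first vertex occurs again in the shortened remainder, everything
  before that occurrence is dropped.\<close>

lemma chain_shorten:
  assumes "chain u xs v"
  obtains ys where "set ys \<subseteq> set xs" "chain u ys v" "distinct (map src ys)" "v \<notin> src ` set ys"
  using assms
proof (induction xs arbitrary: u thesis)
  case Nil
  then show ?case by (metis chain.simps(1) distinct.simps(1) empty_iff image_empty list.set(1) list.simps(8) subset_refl)
next
  case (Cons d xs)
  obtain ys where ys: "set ys \<subseteq> set xs" "chain (tgt d) ys v" "distinct (map src ys)" "v \<notin> src ` set ys"
    using Cons.IH[of "tgt d"] Cons.prems(2) by auto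
  have u: "src d = u" using Cons.prems by simp
  consider "u = v" | "u \<noteq> v" "u \<notin> src ` set ys" | "u \<in> src ` set ys" by blast
  then show ?case
  proof cases
    case 1
    then show ?thesis using Cons.prems(1)[of "[]"] by simp
  next
    case 2
    then show ?thesis using Cons.prems(1)[of "d # ys"] ys u by auto
  next
    case 3
    then obtain d' where "d' \<in> set ys" "src d' = u" by blast
    then obtain as bs where split: "ys = as @ d' # bs" by (meson split_list)
    then have "chain u (d' # bs) v" using ys(2) \<open>src d' = u\<close> by (auto simp: chain_append)
    then show ?thesis using Cons.prems(1)[of "d' # bs"] ys split by auto
  qed
qed

lemma chain_first_hit:
  assumes "chain u xs v" "v \<in> W"
  obtains ys a where "set ys \<subseteq> set xs" "chain u ys a" "a \<in> W" "src ` set ys \<inter> W = {}"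
  using assms
proof (induction xs arbitrary: u thesis)
  case Nil
  then show ?case using Nil.prems(1)[of "[]" u] by simp
next
  case (Cons d xs)
  show ?case
  proof (cases "u \<in> W")
    case True
    then show ?thesis using Cons.prems(1)[of "[]" u] by simp
  next
    case False
    obtain ys a where "set ys \<subseteq> set xs" "chain (tgt d) ys a" "a \<in> W" "src ` set ys \<inter> W = {}"
      using Cons.IH[of "tgt d"] Cons.prems by auto
    then show ?thesis using Cons.prems(1)[of "d # ys" a] Cons.prems(2) False by auto
  qed
qed

text \<open>A second use of an edge, in either direction, would visit the source of its first use
  again.\<close>

lemma distinct_fst_ipath: "ipath u xs v \<Longrightarrow> distinct (map fst xs)"
proof (induction xs arbitrary: u)
  case (Cons d xs)
  then have xs: "ipath (tgt d) xs v" by (auto simp: ipath_def)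
  have "fst d \<noteq> fst d'" if "d' \<in> set xs" for d'
  proof
    assume "fst d = fst d'"
    then consider "d' = d" | "d' = rev_dart d" by (metis fst_eq_dart)
    then have "src d \<in> insert v (src ` set xs)"
    proof cases
      case 2
      then have "src d \<in> tgt ` set xs" using that by force
      then show ?thesis using chain_tgt[of "tgt d" xs v] xs by (auto simp: ipath_def)
    qed (use that in auto)
    then show False using Cons.prems by (auto simp: ipath_def)
  qed
  then show ?case using Cons.IH[OF xs] by auto
qed simp

lemma ipath_rev:
  assumes "ipath u xs v"
  shows "ipath v (rev (map rev_dart xs)) u"
proof -
  have "distinct (map src (rev (map rev_dart xs))) \<and> u \<notin> src ` set (rev (map rev_dart xs))"
    using assms
  proof (induction xs arbitrary: u)
    case (Cons d xs)
    then have xs: "ipath (tgt d) xs v" by (auto simp: ipath_def)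
    have "src d \<notin> insert v (src ` set xs)" using Cons.prems by (auto simp: ipath_def)
    then have "src d \<notin> insert (tgt d) (tgt ` set xs)"
      using chain_tgt[of "tgt d" xs v] xs by (auto simp: ipath_def)
    then show ?case using Cons.IH[OF xs] Cons.prems by (auto simp: ipath_def)
  qed simp
  then show ?thesis using assms chain_rev[of u xs v] by (auto simp: ipath_def)
qed

lemma cyc_Cons: "cyc (d # xs) \<longleftrightarrow> d \<in> darts \<and> ipath (tgt d) xs (src d) \<and> fst d \<notin> fst ` set xs"
  using distinct_fst_ipath[of "tgt d" xs "src d"] by (auto simp: cyc_def ipath_def)

lemma cyc_rotate: "cyc (xs @ ys) \<Longrightarrow> cyc (ys @ xs)"
  by (cases xs; cases ys) (auto simp: cyc_def chain_append)

lemma cyc_append: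
  assumes "ipath a xs b" "ipath b ys a" "a \<noteq> b"
    and "src ` set xs \<inter> src ` set ys = {}" "fst ` set xs \<inter> fst ` set ys = {}"
  shows "cyc (xs @ ys)"
proof -
  have "xs \<noteq> []" using assms by (auto simp: ipath_def)
  then have "src (hd xs) = a" using assms(1) by (cases xs) (auto simp: ipath_def)
  then show ?thesis
    using assms \<open>xs \<noteq> []\<close> distinct_fst_ipath[OF assms(1)] distinct_fst_ipath[OF assms(2)]
    by (auto simp: cyc_def ipath_def chain_append)
qed

lemma cyc_split:
  assumes "cyc xs" "a \<in> src ` set xs" "b \<in> src ` set xs" "a \<noteq> b"
  obtains p q where "ipath a p b" "ipath b q a" "set xs = set p \<union> set q"
    "src ` set p \<inter> src ` set q = {}" "fst ` set p \<inter> fst ` set q = {}"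
proof -
  obtain d where "d \<in> set xs" "src d = a" using assms by blast
  then obtain us vs where "xs = us @ d # vs" by (meson split_list)
  then have c: "cyc (d # vs @ us)" and s: "set xs = set (d # vs @ us)"
    using cyc_rotate[of us "d # vs"] assms by auto
  obtain d' where d': "d' \<in> set (vs @ us)" "src d' = b" using s assms \<open>src d = a\<close> by auto
  then obtain ps qs where pq: "vs @ us = ps @ d' # qs" by (meson split_list)
  show thesis
  proof
    show "ipath a (d # ps) b" "ipath b (d' # qs) a"
      using c[unfolded pq] \<open>src d = a\<close> \<open>src d' = b\<close> by (auto simp: cyc_def ipath_def chain_append)
    show "set xs = set (d # ps) \<union> set (d' # qs)" unfolding s pq by auto
    show "src ` set (d # ps) \<inter> src ` set (d' # qs) = {}" "fst ` set (d # ps) \<inter> fst ` set (d' # qs) = {}"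
      using c[unfolded pq] by (auto simp: cyc_def)
  qed
qed

lemma cyc_rev: "cyc xs \<Longrightarrow> cyc (rev (map rev_dart xs))"
proof -
  assume c: "cyc xs"
  then obtain d ys where xs: "xs = d # ys" by (cases xs) (auto simp: cyc_def)
  have "ipath (src d) (rev (map rev_dart ys)) (tgt d)"
    using c ipath_rev unfolding xs cyc_Cons by blast
  then have "cyc (rev_dart d # rev (map rev_dart ys))"
    using c unfolding xs cyc_Cons by (auto simp: image_image)
  then show ?thesis using cyc_rotate[of "[rev_dart d]"] by (simp add: xs)
qed

section \<open>Curves traced by walks\<close>

lemma walk_curve_chain:
  assumes "set xs \<subseteq> darts" "xs \<noteq> []" "chain u xs v"
  shows "path (walk_curve G xs)" "pathstart (walk_curve G xs) = u" "pathfinish (walk_curve G xs) = v"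
    "path_image (walk_curve G xs) = (\<Union>d\<in>set xs. img d)"
proof -
  have "path (walk_curve G xs) \<and> pathstart (walk_curve G xs) = u \<and> pathfinish (walk_curve G xs) = v
    \<and> path_image (walk_curve G xs) = (\<Union>d\<in>set xs. img d)"
    using assms
  proof (induction xs arbitrary: u)
    case (Cons d xs)
    show ?case
    proof (cases xs)
      case Nil
      then show ?thesis using Cons.prems path_dart[of d] by simp
    next
      case (Cons d' xs')
      then show ?thesis using Cons.IH[of "tgt d"] Cons.prems path_dart[of d]
        by (auto simp: path_image_join)
    qed
  qed simp
  then show "path (walk_curve G xs)" "pathstart (walk_curve G xs) = u" "pathfinish (walk_curve G xs) = v"
    "path_image (walk_curve G xs) = (\<Union>d\<in>set xs. img d)" by auto
qed

lemma winding_number_walk_curve: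
  assumes "set xs \<subseteq> darts" "xs \<noteq> []" "chain u xs v" "\<forall>d\<in>set xs. z \<notin> img d"
  shows "winding_number (walk_curve G xs) z = (\<Sum>d\<leftarrow>xs. winding_number (dart_curve G d) z)"
  using assms
proof (induction xs arbitrary: u)
  case (Cons d xs)
  show ?case
  proof (cases xs)
    case (Cons d' xs')
    note w = walk_curve_chain[of xs "tgt d" v]
    have "winding_number (walk_curve G (d # xs)) z =
      winding_number (dart_curve G d) z + winding_number (walk_curve G xs) z"
      using w Cons.prems Cons path_dart[of d] by (auto intro!: winding_number_join)
    then show ?thesis using Cons.IH[of "tgt d"] Cons.prems Cons by auto
  qed simp
qed simp

lemma walk_vertices:
  assumes "set xs \<subseteq> darts" "chain u xs v"
  shows "(\<Union>d\<in>set xs. img d) \<inter> vertices G \<subseteq> insert v (src ` set xs)"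
proof -
  have "(\<Union>d\<in>set xs. img d) \<inter> vertices G \<subseteq> src ` set xs \<union> tgt ` set xs"
    using img_Int_vertices assms(1) by blast
  then show ?thesis using chain_tgt[OF assms(2)] by blast
qed

lemma img_Int_walk:
  assumes "d \<in> darts" "set xs \<subseteq> darts" "chain u xs v" "fst d \<notin> fst ` set xs"
  shows "img d \<inter> (\<Union>d\<in>set xs. img d) \<subseteq> {src d, tgt d} \<inter> insert v (src ` set xs)"
proof -
  have "img d \<inter> (\<Union>d\<in>set xs. img d) \<subseteq> vertices G"
    using img_Int_img[OF assms(1)] assms by blast
  then show ?thesis using walk_vertices[OF assms(2,3)] img_Int_vertices[OF assms(1)] by blast
qed

text \<open>Different edges meet in vertices only, and the source of the first dart is not visited
  again; so the first edge meets the rest in its target alone.\<close>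

lemma arc_walk_curve: "ipath u xs v \<Longrightarrow> xs \<noteq> [] \<Longrightarrow> arc (walk_curve G xs)"
proof (induction xs arbitrary: u)
  case (Cons d xs)
  show ?case
  proof (cases xs)
    case Nil
    then show ?thesis using Cons.prems arc_dart[of d] by (simp add: ipath_def)
  next
    case (Cons d' xs')
    have xs: "ipath (tgt d) xs v" "d \<in> darts" "fst d \<notin> fst ` set xs" "src d \<notin> insert v (src ` set xs)"
      using Cons.prems distinct_fst_ipath[OF Cons.prems(1)] by (auto simp: ipath_def)
    then have "img d \<inter> (\<Union>d\<in>set xs. img d) \<subseteq> {tgt d}"
      using img_Int_walk[of d xs "tgt d" v] by (auto simp: ipath_def)
    then have "arc (dart_curve G d +++ walk_curve G xs)"
      using xs arc_dart[of d] Cons.IH[OF xs(1)] Cons walk_curve_chain[of xs "tgt d" v]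
      by (intro arc_join) (auto simp: ipath_def)
    then show ?thesis using Cons by simp
  qed
qed simp

text \<open>The remainder of a cycle through \<open>d\<close> is a closing arc of the kind that the
  definition of \<open>left_of\<close> asks for.\<close>

lemma cyc_closing:
  assumes "cyc (d # xs)"
  shows "xs \<noteq> []" "walk_curve G (d # xs) = dart_curve G d +++ walk_curve G xs"
    "pathstart (walk_curve G xs) = tgt d" "pathfinish (walk_curve G xs) = src d"
    "path_image (walk_curve G xs) = (\<Union>d\<in>set xs. img d)" "simple_path (dart_curve G d +++ walk_curve G xs)"
    "arc (walk_curve G xs)" "img d \<inter> (\<Union>d\<in>set xs. img d) = {src d, tgt d}"
proof -
  have xs: "d \<in> darts" "ipath (tgt d) xs (src d)" "fst d \<notin> fst ` set xs"
    using assms by (auto simp: cyc_Cons)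
  show "xs \<noteq> []" using xs src_neq_tgt[OF xs(1)] by (auto simp: ipath_def)
  then show "walk_curve G (d # xs) = dart_curve G d +++ walk_curve G xs" by (cases xs) auto
  have w: "set xs \<subseteq> darts" "chain (tgt d) xs (src d)" using xs by (auto simp: ipath_def)
  note * = walk_curve_chain[OF w(1) \<open>xs \<noteq> []\<close> w(2)]
  show pi: "pathstart (walk_curve G xs) = tgt d" "pathfinish (walk_curve G xs) = src d"
    "path_image (walk_curve G xs) = (\<Union>d\<in>set xs. img d)" using * by auto
  show arc: "arc (walk_curve G xs)" using arc_walk_curve xs \<open>xs \<noteq> []\<close> by blast
  have I: "img d \<inter> (\<Union>d\<in>set xs. img d) \<subseteq> {src d, tgt d}"
    using img_Int_walk[OF xs(1) w xs(3)] by blast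
  then show "simple_path (dart_curve G d +++ walk_curve G xs)"
    using arc arc_dart xs pi by (intro simple_path_join_loop) auto
  have "src d \<in> (\<Union>d\<in>set xs. img d)" "tgt d \<in> (\<Union>d\<in>set xs. img d)"
    using pi by (metis pathstart_in_path_image pathfinish_in_path_image)+
  then show "img d \<inter> (\<Union>d\<in>set xs. img d) = {src d, tgt d}"
    using I img_Int_vertices[OF xs(1)] by blast
qed

lemma cyc_curve:
  assumes "cyc xs"
  shows "simple_path (walk_curve G xs)" "pathfinish (walk_curve G xs) = pathstart (walk_curve G xs)"
    "path_image (walk_curve G xs) = (\<Union>d\<in>set xs. img d)"
    "(\<Union>d\<in>set xs. img d) \<inter> vertices G = src ` set xs"
proof -
  obtain d ys where xs: "xs = d # ys" using assms by (cases xs) (auto simp: cyc_def)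
  note c = cyc_closing[OF assms[unfolded xs]]
  show "simple_path (walk_curve G xs)" "pathfinish (walk_curve G xs) = pathstart (walk_curve G xs)"
    "path_image (walk_curve G xs) = (\<Union>d\<in>set xs. img d)"
    unfolding xs c(2) using c by (simp_all add: path_image_join)
  have *: "set xs \<subseteq> darts" "chain (src d) xs (src d)" using assms by (auto simp: cyc_def xs)
  have "src ` set xs \<subseteq> (\<Union>d\<in>set xs. img d) \<inter> vertices G"
    using img_Int_vertices *(1) by blast
  then show "(\<Union>d\<in>set xs. img d) \<inter> vertices G = src ` set xs"
    using walk_vertices[OF *] by (auto simp: xs)
qed

section \<open>Walks extracted from the library's connectivity notions\<close>

lemma reachable_imp_chain:
  assumes "(u, v) \<in> rtrancl_on V R" and R: "\<And>x y. (x, y) \<in> R \<Longrightarrow> \<exists>d\<in>A. src d = x \<and> tgt d = y"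
  obtains xs where "set xs \<subseteq> A" "chain u xs v"
  using assms(1)
proof (induction arbitrary: thesis rule: rtrancl_on_induct)
  case base
  then show ?case using base(2)[of "[]"] by simp
next
  case (step y z)
  obtain xs where "set xs \<subseteq> A" "chain u xs y" using step.IH by blast
  moreover obtain d where "d \<in> A" "src d = y" "tgt d = z" using R step by blast
  ultimately show ?case using step.prems[of "xs @ [d]"] by (auto simp: chain_append)
qed

text \<open>The library's connectedness is reachability in the symmetric closure, so a step may run
  against an arc; this is why \<open>A\<close> has to contain the reversed darts.\<close>

lemma connected_imp_chain:
  assumes "Digraph_Component.connected H" "u \<in> verts H" "v \<in> verts H"
    and "tail H = (\<lambda>d. src d)" "head H = (\<lambda>d. tgt d)" and A: "\<And>d. d \<in> arcs H \<Longrightarrow> d \<in> A \<and> rev_dart d \<in> A"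
  obtains xs where "set xs \<subseteq> A" "chain u xs v"
proof (rule reachable_imp_chain)
  show "(u, v) \<in> rtrancl_on (verts H) (arcs_ends (with_proj (mk_symmetric H)))"
    using assms(1-3) unfolding Digraph_Component.connected_def strongly_connected_def reachable_def
    by (auto simp: mk_symmetric_def)
  show "\<exists>d\<in>A. src d = x \<and> tgt d = y" if xy: "(x, y) \<in> arcs_ends (with_proj (mk_symmetric H))" for x y
  proof -
    obtain d where "d \<in> arcs H" "(x, y) = (src d, tgt d) \<or> (x, y) = (tgt d, src d)"
      using xy assms(4,5) by (auto simp: mk_symmetric_def arcs_ends_def arc_to_ends_def)
    then show ?thesis using A[of d] by (metis dart_curve_rev_dart pathfinish_reversepath pathstart_reversepath prod.inject)
  qed
qed (use that in blast)

lemma strongly_connected_imp_chain: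
  assumes "strongly_connected (digraph_of G D)" "u \<in> vertices G" "v \<in> vertices G"
  obtains xs where "set xs \<subseteq> D" "chain u xs v"
proof (rule reachable_imp_chain)
  show "(u, v) \<in> rtrancl_on (vertices G) (arcs_ends (digraph_of G D))"
    using assms unfolding strongly_connected_def reachable_def by (auto simp: digraph_of_def)
  show "\<exists>d\<in>D. src d = x \<and> tgt d = y" if "(x, y) \<in> arcs_ends (digraph_of G D)" for x y
    using that by (auto simp: digraph_of_def arcs_ends_def arc_to_ends_def)
qed (use that in blast)

end

section \<open>Faces are bounded by cycles\<close>

lemma path_image_subset_closure_endless:
  "simple_path c \<Longrightarrow> path_image c \<subseteq> closure (path_image c - {pathstart c, pathfinish c})"
proof -
  assume c: "simple_path c"
  have "c ` closure {0<..<1} \<subseteq> closure (c ` {0<..<1})"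
    using c simple_path_imp_path[OF c]
    by (intro continuous_image_closure_subset[of "{0..1}"]) (auto simp: path_def)
  then show ?thesis
    using simple_path_endless[OF c] by (simp add: path_image_def closure_greaterThanLessThan)
qed

locale two_connected_plane_graph = plane_graph_drawing G for G :: "'e plane_drawing" +
  assumes two: "two_connected G"
begin

section \<open>The drawing as a point set, and walks from 2-connectedness\<close>

definition drawing :: "complex set" where
  "drawing = vertices G \<union> (\<Union>e\<in>edges G. path_image (curve G e))"

abbreviation support :: "'e dart list \<Rightarrow> complex set" where
  "support xs \<equiv> (\<Union>d\<in>set xs. img d)"

lemma faces_eq: "faces G = components (- drawing)"
  by (simp add: faces_def drawing_def)

lemma compact_drawing: "compact drawing"
  unfolding drawing_def
  by (intro compact_Un finite_imp_compact[OF finite_vertices] compact_UN[OF finite_edges] compact_path_image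
      arc_imp_path arc_curve)

lemma closed_drawing: "closed drawing"
  by (simp add: compact_drawing compact_imp_closed)

lemma img_subset_drawing: "d \<in> darts \<Longrightarrow> img d \<subseteq> drawing"
  by (auto simp: drawing_def in_darts)

lemma support_subset_drawing: "set xs \<subseteq> darts \<Longrightarrow> support xs \<subseteq> drawing"
  using img_subset_drawing by blast

lemma compact_support: "set xs \<subseteq> darts \<Longrightarrow> compact (support xs)"
  by (intro compact_UN compact_path_image arc_imp_path arc_curve) (auto simp: in_darts)

lemma chain_in_graph:
  assumes "u \<in> vertices G" "v \<in> vertices G"
  obtains xs where "set xs \<subseteq> darts" "chain u xs v"
  using assms two
  by (rule_tac connected_imp_chain[of "graph_of G" u v darts])
    (auto simp: two_connected_def graph_of_def digraph_of_def darts_def rev_dart_in_darts[unfolded darts_def])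

lemma chain_avoiding:
  assumes "u \<in> vertices G" "v \<in> vertices G" "w \<in> vertices G" "u \<noteq> w" "v \<noteq> w"
  obtains xs where "set xs \<subseteq> {d \<in> darts. src d \<noteq> w \<and> tgt d \<noteq> w}" "chain u xs v"
  using assms two
  by (rule_tac connected_imp_chain[of "pre_digraph.del_vert (graph_of G) w" u v "{d \<in> darts. src d \<noteq> w \<and> tgt d \<noteq> w}"])
    (auto simp: two_connected_def graph_of_def digraph_of_def pre_digraph.del_vert_def darts_def
      rev_dart_in_darts[unfolded darts_def])

lemma ex_other_vertex:
  assumes "a \<in> vertices G" "b \<in> vertices G"
  obtains w where "w \<in> vertices G" "w \<noteq> a" "w \<noteq> b"
proof -
  have "card {a, b} \<le> 2" by (simp add: card_insert_if)
  moreover have "card (vertices G) > 2" using two by (simp add: two_connected_def)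
  ultimately have "\<not> vertices G \<subseteq> {a, b}" using card_mono[of "{a, b}" "vertices G"] by auto
  then show thesis using that by blast
qed

text \<open>With a third vertex \<open>w\<close>, walk from the head of \<open>d\<close> to
  \<open>w\<close> avoiding the tail, then to the tail avoiding the head. Neither part can use the
  edge of \<open>d\<close>, which has both ends, and loop erasure makes the return walk a
  path.\<close>

lemma ex_cyc:
  assumes "d \<in> darts"
  obtains xs where "cyc (d # xs)"
proof -
  let ?u = "src d" and ?v = "tgt d"
  have V: "?u \<in> vertices G" "?v \<in> vertices G" using assms src_in_vertices tgt_in_vertices by auto
  then obtain w where w: "w \<in> vertices G" "w \<noteq> ?u" "w \<noteq> ?v" using ex_other_vertex by metis
  obtain xs where xs: "set xs \<subseteq> {a \<in> darts. src a \<noteq> ?u \<and> tgt a \<noteq> ?u}" "chain ?v xs w"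
    using chain_avoiding[OF V(2) w(1) V(1) src_neq_tgt[OF assms, symmetric] w(2)] by blast
  obtain ys where ys: "set ys \<subseteq> {a \<in> darts. src a \<noteq> ?v \<and> tgt a \<noteq> ?v}" "chain w ys ?u"
    using chain_avoiding[OF w(1) V(1) V(2) w(3) src_neq_tgt[OF assms]] by blast
  have "chain ?v (xs @ ys) ?u" using xs ys by (auto simp: chain_append)
  then obtain zs where zs: "set zs \<subseteq> set (xs @ ys)" "chain ?v zs ?u" "distinct (map src zs)" "?u \<notin> src ` set zs"
    by (rule chain_shorten)
  have "fst a \<noteq> fst d" if a: "a \<in> set (xs @ ys)" for a
  proof
    assume "fst a = fst d"
    then consider "a = d" | "a = rev_dart d" by (metis fst_eq_dart)
    then have "(src a = ?u \<or> tgt a = ?u) \<and> (src a = ?v \<or> tgt a = ?v)" by cases auto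
    then show False using a xs(1) ys(1) by auto
  qed
  then have "fst d \<notin> fst ` set zs" using zs(1) by force
  moreover have "set zs \<subseteq> darts" using zs(1) xs(1) ys(1) by fastforce
  ultimately have "cyc (d # zs)" using zs assms by (auto simp: cyc_Cons ipath_def)
  then show thesis by (rule that)
qed

lemma edges_nonempty: "edges G \<noteq> {}"
proof -
  have "vertices G \<noteq> {}" using two by (auto simp: two_connected_def)
  then obtain u v where "u \<in> vertices G" "v \<in> vertices G" "u \<noteq> v" using ex_other_vertex by blast
  then obtain xs where "set xs \<subseteq> darts" "chain u xs v" using chain_in_graph by blast
  then show ?thesis using \<open>u \<noteq> v\<close> by (cases xs) auto
qed

section \<open>Edges and ears inside one side of a cycle\<close>

context
  fixes C S
  assumes C: "cyc C" and S: "S \<in> components (- support C)"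
begin

lemma C_darts: "set C \<subseteq> darts"
  using C by (simp add: cyc_def)

lemma frontier_component_cyc: "frontier S = support C"
  using frontier_component_Jordan[OF cyc_curve(1,2)[OF C]] S cyc_curve(3)[OF C] by simp

lemma open_component_cyc: "open S"
  by (rule open_components[OF open_Compl[OF compact_imp_closed[OF compact_support[OF C_darts]]] S])

text \<open>Off its ends, such an edge is connected and misses the cycle, since edges meet in
  vertices only. It therefore cannot leave the side \<open>S\<close>.\<close>

lemma edge_in_component:
  assumes d: "d \<in> darts" and meets: "img d \<inter> S \<noteq> {}"
  shows "fst d \<notin> fst ` set C" "img d \<subseteq> S \<union> support C"
proof -
  have disj: "S \<inter> support C = {}" using in_components_subset[OF S] by blast
  show nC: "fst d \<notin> fst ` set C"
  proof
    assume "fst d \<in> fst ` set C"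
    then have "img d \<subseteq> support C" by auto
    then show False using disj meets by blast
  qed
  define I where "I = img d - {src d, tgt d}"
  have sp: "simple_path (dart_curve G d)" using arc_dart[OF d] arc_imp_simple_path by blast
  have cl: "img d \<subseteq> closure I"
    using path_image_subset_closure_endless[OF sp] by (simp add: I_def)
  have "img d \<inter> support C \<subseteq> vertices G"
    using img_Int_img[OF d] C_darts nC by blast
  then have "I \<subseteq> - support C" using img_Int_vertices[OF d] unfolding I_def by blast
  moreover have "connected I" using connected_simple_path_endless[OF sp] by (simp add: I_def)
  moreover have "S \<inter> I \<noteq> {}"
    using open_Int_closure_eq_empty[OF open_component_cyc, of I] cl meets by blast
  ultimately have "I \<subseteq> S" using components_maximal[OF S] by blast
  then have "img d \<subseteq> closure S" using cl closure_mono by blast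
  then show "img d \<subseteq> S \<union> support C"
    using closure_Un_frontier[of S] frontier_component_cyc by blast
qed

text \<open>The walk could leave \<open>S\<close> only at a vertex of \<open>C\<close>, which would
  then be the source of the next dart unless the walk ends there. So every edge, the last one
  included, starts in \<open>S\<close>.\<close>

lemma walk_in_component:
  assumes "chain u xs v" "set xs \<subseteq> darts" "u \<in> S" "src ` set xs \<inter> src ` set C = {}" "d \<in> set xs"
  shows "img d \<inter> S \<noteq> {}"
  using assms
proof (induction xs arbitrary: u)
  case (Cons d' xs)
  have d': "d' \<in> darts" "src d' = u" using Cons.prems by auto
  then have m: "img d' \<inter> S \<noteq> {}" using img_Int_vertices Cons.prems(3) by blast
  show ?case
  proof (cases "d = d'")
    case False
    then have "d \<in> set xs" using Cons.prems by auto
    moreover have "tgt d' \<in> S"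
    proof (rule ccontr)
      assume "tgt d' \<notin> S"
      then have "tgt d' \<in> support C" "tgt d' \<in> vertices G"
        using edge_in_component(2)[OF d'(1) m] img_Int_vertices[OF d'(1)] by auto
      then have "tgt d' \<in> src ` set C" using cyc_curve(4)[OF C] by blast
      moreover have "tgt d' \<in> src ` set xs"
        using Cons.prems(1) \<open>d \<in> set xs\<close> by (cases xs) auto
      ultimately show False using Cons.prems(4) by auto
    qed
    ultimately show ?thesis using Cons.IH[of "tgt d'"] Cons.prems by auto
  qed (use m in simp)
qed simp

text \<open>If \<open>S\<close> contains no vertex, a single edge is the ear. Otherwise take a
  vertex in \<open>S\<close>, walk until the cycle is hit at \<open>a\<close>, and walk again
  avoiding \<open>a\<close>, as 2-connectedness permits, until it is hit at some \<open>b\<close>.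
  The reversed first walk followed by the second, with loops erased, is the ear.\<close>

lemma ex_ear:
  assumes "drawing \<inter> S \<noteq> {}"
  obtains a p b where "a \<noteq> b" "a \<in> src ` set C" "b \<in> src ` set C" "ipath a p b"
    "\<And>d. d \<in> set p \<Longrightarrow> img d \<inter> S \<noteq> {}" "src ` set p \<inter> src ` set C \<subseteq> {a}"
proof (cases "vertices G \<inter> S = {}")
  case True
  then obtain e where e: "e \<in> edges G" "img (e, True) \<inter> S \<noteq> {}"
    using assms by (auto simp: drawing_def)
  let ?d = "(e, True)"
  have d: "?d \<in> darts" using e by simp
  note sub = edge_in_component(2)[OF d e(2)]
  have *: "w \<in> src ` set C" if "w \<in> {src ?d, tgt ?d}" for w
  proof -
    have "w \<in> img ?d" "w \<in> vertices G" using img_Int_vertices[OF d] that by blast+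
    then have "w \<in> support C \<inter> vertices G" using sub True by blast
    then show ?thesis using cyc_curve(4)[OF C] by blast
  qed
  show thesis
    by (rule that[of "src ?d" "tgt ?d" "[?d]"])
      (use * src_neq_tgt[OF d] e in \<open>auto simp: ipath_def\<close>)
next
  case False
  then obtain u where u: "u \<in> vertices G" "u \<in> S" by blast
  let ?W = "src ` set C"
  have WV: "?W \<subseteq> vertices G" using src_in_vertices C_darts by blast
  have uW: "u \<notin> ?W" using cyc_curve(4)[OF C] u in_components_subset[OF S] by blast
  obtain d C' where Cd: "C = d # C'" using C by (cases C) (auto simp: cyc_def)
  have "tgt ` set C = ?W" using chain_tl_tgt[of "src d" d C'] C by (auto simp: cyc_def Cd)
  then have two_W: "src d \<in> ?W" "tgt d \<in> ?W" "src d \<noteq> tgt d"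
    using C src_neq_tgt[of d] by (auto simp: Cd cyc_def)
  obtain xs where "set xs \<subseteq> darts" "chain u xs (src d)"
    using chain_in_graph[OF u(1)] two_W WV by blast
  then obtain ys a where ys: "set ys \<subseteq> darts" "chain u ys a" "a \<in> ?W" "src ` set ys \<inter> ?W = {}"
    using chain_first_hit[of u xs "src d" ?W] two_W by (metis subset_trans)
  obtain w where w: "w \<in> ?W" "w \<noteq> a" using two_W by metis
  obtain xs' where xs': "set xs' \<subseteq> {d \<in> darts. src d \<noteq> a \<and> tgt d \<noteq> a}" "chain u xs' w"
    using chain_avoiding[of u w a] u w ys uW WV by blast
  obtain zs b where zs: "set zs \<subseteq> set xs'" "chain u zs b" "b \<in> ?W" "src ` set zs \<inter> ?W = {}"
    using chain_first_hit[OF xs'(2) w(1)] by metis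
  have zs': "set zs \<subseteq> darts" using zs(1) xs'(1) by blast
  have "b \<in> insert u (tgt ` set zs)" unfolding chain_tgt[OF zs(2)] by simp
  moreover have "b \<noteq> u" using zs(3) uW by blast
  ultimately have "b \<in> tgt ` set zs" by simp
  moreover have "tgt c \<noteq> a" if "c \<in> set zs" for c
    using subsetD[OF xs'(1) subsetD[OF zs(1) that]] by simp
  ultimately have "a \<noteq> b" by blast
  have "chain a (rev (map rev_dart ys) @ zs) b"
    using chain_rev[OF ys(2)] zs(2) by (auto simp: chain_append)
  then obtain p where p: "set p \<subseteq> set (rev (map rev_dart ys) @ zs)" "chain a p b" "distinct (map src p)" "b \<notin> src ` set p"
    by (rule chain_shorten)
  have mem: "d \<in> rev_dart ` set ys \<or> d \<in> set zs" if "d \<in> set p" for d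
    using p(1) that by auto
  show thesis
  proof (rule that[OF \<open>a \<noteq> b\<close> ys(3) zs(3)])
    have "d \<in> darts" if "d \<in> set p" for d
      using mem[OF that] ys(1) zs' by (metis image_iff rev_dart_in_darts subsetD)
    then show "ipath a p b" using p by (auto simp: ipath_def)
    show "img d \<inter> S \<noteq> {}" if "d \<in> set p" for d
      using mem[OF that]
    proof
      assume "d \<in> rev_dart ` set ys"
      then obtain d' where "d' \<in> set ys" "d = rev_dart d'" by blast
      then show ?thesis using walk_in_component[OF ys(2,1) u(2) ys(4), of d'] by simp
    qed (use walk_in_component[OF zs(2) zs' u(2) zs(4)] in blast)
    show "src ` set p \<inter> ?W \<subseteq> {a}"
    proof clarify
      fix d c assume d: "d \<in> set p" and c: "src d = src c" "c \<in> set C"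
      from mem[OF d] show "src d = a"
      proof
        assume "d \<in> rev_dart ` set ys"
        then obtain d' where "d' \<in> set ys" "d = rev_dart d'" by blast
        then have "src d \<in> insert a (src ` set ys)" using chain_tgt[OF ys(2)] by auto
        then show ?thesis using ys(4) c by auto
      qed (use zs(4) c in auto)
    qed
  qed
qed

end

text \<open>
  Among the cycles, consider one whose side containing the face meets as few edges as possible.
  If that side were not the face itself, an ear through it would give a better cycle.
\<close>

lemma face_bounded_by_cyc:
  assumes f: "f \<in> faces G"
  obtains C where "cyc C" "f \<in> components (- support C)"
proof -
  define P where "P = (\<lambda>(C, S). cyc C \<and> S \<in> components (- support C) \<and> f \<subseteq> S)"
  define m where "m = (\<lambda>(C :: 'e dart list, S). card {e \<in> edges G. path_image (curve G e) \<inter> S \<noteq> {}})"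
  have fD: "f \<subseteq> - drawing" "connected f" "f \<noteq> {}"
    using f in_components_subset in_components_connected in_components_nonempty unfolding faces_eq by blast+
  obtain x where x: "x \<in> f" using fD by blast
  obtain e where "e \<in> edges G" using edges_nonempty by blast
  then obtain xs where xs: "cyc ((e, True) # xs)" using ex_cyc[of "(e, True)"] by auto
  let ?xs = "(e, True) # xs"
  have fxs: "f \<subseteq> - support ?xs"
    using fD(1) support_subset_drawing[of ?xs] xs unfolding cyc_def by blast
  then have "- support ?xs \<noteq> {}" using fD(3) by blast
  then obtain S0 where "S0 \<in> components (- support ?xs)" "f \<subseteq> S0"
    using exists_component_superset[OF fxs _ fD(2)] by blast
  then have "P (?xs, S0)" using xs by (simp add: P_def)
  then obtain CS where CS: "P CS" "\<And>y. P y \<Longrightarrow> m CS \<le> m y"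
    using ex_has_least_nat[of P _ m] by blast
  obtain C S where CS': "CS = (C, S)" by (cases CS)
  have C: "cyc C" and S: "S \<in> components (- support C)" and fS: "f \<subseteq> S"
    using CS(1) by (auto simp: P_def CS')
  have "drawing \<inter> S = {}"
  proof (rule ccontr)
    assume "drawing \<inter> S \<noteq> {}"
    then obtain a p b where ear: "a \<noteq> b" "a \<in> src ` set C" "b \<in> src ` set C" "ipath a p b"
      "\<And>d. d \<in> set p \<Longrightarrow> img d \<inter> S \<noteq> {}" "src ` set p \<inter> src ` set C \<subseteq> {a}"
      using ex_ear[OF C S] by metis
    obtain q r where qr: "ipath a q b" "ipath b r a" "set C = set q \<union> set r"
      "src ` set q \<inter> src ` set r = {}" "fst ` set q \<inter> fst ` set r = {}"
      using cyc_split[OF C ear(2,3,1)] by metis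
    have pd: "set p \<subseteq> darts" "chain a p b" "p \<noteq> []" and qd: "set q \<subseteq> darts" "chain a q b" and rd: "set r \<subseteq> darts" "chain b r a"
      using ear qr by (auto simp: ipath_def)
    have p_edges: "fst ` set p \<inter> fst ` set C = {}"
      using edge_in_component(1)[OF C S] ear(5) pd(1) by blast
    have p_sub: "support p \<subseteq> S \<union> support C"
      by (intro UN_least edge_in_component(2)[OF C S] subsetD[OF pd(1)] ear(5))
    let ?p' = "rev (map rev_dart p)"
    have p': "ipath b ?p' a" using ipath_rev[OF ear(4)] .
    have sup_p': "support ?p' = support p" by auto
    \<comment> \<open>Exchanging one of the arcs \<open>q\<close>, \<open>r\<close> of
      \<open>C\<close> for the ear gives two cycles. For one of them,
      \<open>theta_component_subset\<close> places the component of \<open>x\<close> inside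
      \<open>S\<close>.\<close>
    have cyc1: "cyc (p @ r)"
    proof (rule cyc_append[OF ear(4) qr(2) ear(1)])
      have "a \<notin> src ` set r" using qr(2) by (auto simp: ipath_def)
      then show "src ` set p \<inter> src ` set r = {}" using ear(6) qr(3) by blast
      show "fst ` set p \<inter> fst ` set r = {}" using p_edges qr(3) by blast
    qed
    have cyc2: "cyc (q @ ?p')"
    proof (rule cyc_append[OF qr(1) p' ear(1)])
      have "src ` set ?p' = tgt ` set p" by (simp add: image_image)
      then have "src ` set ?p' \<subseteq> insert b (src ` set p)"
        using equalityD1[OF chain_tgt[OF pd(2)]] by simp
      moreover have "src ` set q \<subseteq> src ` set C" unfolding qr(3) by blast
      ultimately have "src ` set q \<inter> src ` set ?p' \<subseteq> {a, b}" using ear(6) by fast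
      moreover have "a \<notin> src ` set ?p'" using p' by (simp only: ipath_def simp_thms)
      moreover have "b \<notin> src ` set q" using qr(1) by (simp only: ipath_def simp_thms)
      ultimately show "src ` set q \<inter> src ` set ?p' = {}" by fast
      have "fst ` set ?p' = fst ` set p" by (simp add: image_image)
      then show "fst ` set q \<inter> fst ` set ?p' = {}" using p_edges qr(3) by blast
    qed
    have supC: "support C = support q \<union> support r" by (simp add: qr(3))
    obtain S' where S': "S' \<in> components (- support C)" "S' \<noteq> S" "S' \<inter> S = {}"
      using components_Compl_Jordan_obtain[OF cyc_curve(1,2)[OF C]] S cyc_curve(3)[OF C] by metis
    have V: "support q \<inter> support r \<subseteq> vertices G"
      using img_Int_img qd(1) rd(1) qr(5) by blast
    have I: "support q \<inter> support r \<subseteq> insert b (src ` set q) \<inter> insert a (src ` set r)"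
      by (rule Int_greatest[OF subset_trans[OF Int_greatest[OF Int_lower1 V] walk_vertices[OF qd]]
          subset_trans[OF Int_greatest[OF Int_lower2 V] walk_vertices[OF rd]]])
    have "insert b (src ` set q) \<inter> insert a (src ` set r) \<subseteq> {a, b}"
      using qr(4) by fast
    moreover have "{a, b} \<subseteq> support p"
      using pathstart_in_path_image[of "walk_curve G p"] pathfinish_in_path_image[of "walk_curve G p"]
      unfolding walk_curve_chain[OF pd(1,3,2)] by simp
    \<comment> \<open>The arcs \<open>q\<close> and \<open>r\<close> share only the ends of the ear,
      so the two new cycles meet exactly in the connected set \<open>support p\<close>, as
      Janiszewski's theorem requires.\<close>
    ultimately have int: "support q \<inter> support r \<subseteq> support p"
      by (rule subset_trans[OF I subset_trans])
    have xS: "x \<in> S" using x fS by blast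
    have xp: "x \<notin> support p"
    proof
      assume "x \<in> support p"
      then have "x \<in> drawing" by (rule subsetD[OF support_subset_drawing[OF pd(1)]])
      then show False using subsetD[OF fD(1) x] by simp
    qed
    have conn: "connected (support p)"
      using walk_curve_chain[OF pd(1,3,2)] by (metis connected_path_image)
    have "S' \<inter> X = {}" if "X \<subseteq> S \<union> Y" "S' \<inter> S = {}" "S' \<subseteq> - Y" for X Y
      using that by blast
    from this[OF p_sub S'(3) in_components_subset[OF S'(1)]] have S'p: "S' \<inter> support p = {}" .
    have clS': "support q \<union> support r \<subseteq> closure S'"
      using frontier_component_cyc[OF C S'(1)] closure_Un_frontier[of S'] unfolding supC by blast
    have "connected_component_set (- (support q \<union> support p)) x \<subseteq> S
      \<or> connected_component_set (- (support r \<union> support p)) x \<subseteq> S"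
      by (rule theta_component_subset[OF compact_support[OF qd(1)] compact_support[OF rd(1)]
          compact_support[OF pd(1)] conn int S[unfolded supC] xS xp S'(1)[unfolded supC] S'p clS' S'(2)[symmetric]])
    moreover have "support (p @ r) = support r \<union> support p" "support (q @ ?p') = support q \<union> support p"
      by auto
    ultimately obtain C' where C': "cyc C'" "support p \<subseteq> support C'" "connected_component_set (- support C') x \<subseteq> S"
      using cyc1 cyc2 by (metis Un_upper2)
    let ?S = "connected_component_set (- support C') x"
    have fC': "f \<subseteq> - support C'"
      using fD(1) support_subset_drawing[of C'] C'(1) unfolding cyc_def by blast
    then have "f \<subseteq> ?S" using fD x by (intro connected_component_maximal) auto
    moreover have "?S \<in> components (- support C')" using fC' x by (intro componentsI) blast
    ultimately have "P (C', ?S)" using C' by (simp add: P_def)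
    \<comment> \<open>The edges of the ear meet \<open>S\<close>, but they belong to the new cycle
      and so miss its sides.\<close>
    moreover have "m (C', ?S) < m CS"
    proof -
      obtain d where d: "d \<in> set p" using pd(3) by (cases p) auto
      have "img d \<subseteq> support C'" using subset_trans[OF _ C'(2), of "img d"] d by auto
      then have "img d \<inter> ?S = {}" using connected_component_subset[of "- support C'" x] by auto
      then have "fst d \<notin> {e \<in> edges G. path_image (curve G e) \<inter> ?S \<noteq> {}}" by simp
      moreover have "fst d \<in> {e \<in> edges G. path_image (curve G e) \<inter> S \<noteq> {}}"
        using ear(5)[OF d] subsetD[OF pd(1) d] by (simp add: in_darts)
      moreover have "{e \<in> edges G. path_image (curve G e) \<inter> X \<noteq> {}} \<subseteq> {e \<in> edges G. path_image (curve G e) \<inter> S \<noteq> {}}"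
        if "X \<subseteq> S" for X
        using that by blast
      note this[OF C'(3)]
      ultimately have "{e \<in> edges G. path_image (curve G e) \<inter> ?S \<noteq> {}} \<subset> {e \<in> edges G. path_image (curve G e) \<inter> S \<noteq> {}}"
        by (metis (no_types, lifting) psubsetI)
      then show ?thesis by (simp add: m_def CS' psubset_card_mono finite_edges)
    qed
    ultimately show False using CS(2) by (simp add: leD)
  qed
  \<comment> \<open>A connected set that misses the drawing and meets \<open>f\<close> lies in
    \<open>f\<close>.\<close>
  then have "S \<subseteq> f"
    using components_maximal[of f "- drawing" S] f fS x in_components_connected[OF S]
    unfolding faces_eq by blast
  then show thesis using that[OF C] S fS by simp
qed

end

section \<open>The two faces at an edge\<close>

lemma simple_path_closingD:
  assumes "pathstart q = pathfinish c" "pathfinish q = pathstart c" "simple_path (c +++ q)"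
  shows "arc c" "path q" "path_image c \<inter> path_image q = {pathstart c, pathfinish c}"
    "path_image (c +++ q) = path_image c \<union> path_image q" "pathfinish (c +++ q) = pathstart (c +++ q)"
proof -
  have *: "arc c \<and> arc q \<and> path_image c \<inter> path_image q \<subseteq> {pathstart c, pathstart q}"
    using assms simple_path_join_loop_eq[of q c] by simp
  then show "arc c" "path q" by (auto simp: arc_imp_path)
  show "path_image c \<inter> path_image q = {pathstart c, pathfinish c}"
    using * assms pathstart_in_path_image[of q] pathfinish_in_path_image[of q]
      pathstart_in_path_image[of c] pathfinish_in_path_image[of c] by auto
  show "path_image (c +++ q) = path_image c \<union> path_image q" using assms by (simp add: path_image_join)
  show "pathfinish (c +++ q) = pathstart (c +++ q)" using assms by simp
qed

text \<open>The winding numbers of the two closed curves differ by those of \<open>p\<close> and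
  \<open>q\<close>, which are continuous at \<open>x\<close> because neither arc passes through it.
  This makes \<open>left_of\<close> independent of the closing arc.\<close>

lemma left_region_closing_unique:
  assumes p: "pathstart p = pathfinish c" "pathfinish p = pathstart c" "simple_path (c +++ p)"
    and q: "pathstart q = pathfinish c" "pathfinish q = pathstart c" "simple_path (c +++ q)"
    and x: "x \<in> path_image c - {pathstart c, pathfinish c}"
  obtains r where "r > 0"
    "\<And>z. z \<in> ball x r - path_image c \<Longrightarrow> z \<in> left_region (c +++ p) \<longleftrightarrow> z \<in> left_region (c +++ q)"
proof -
  note P = simple_path_closingD[OF p] and Q = simple_path_closingD[OF q]
  define U where "U = - (path_image p \<union> path_image q)"
  have U: "open U" "x \<in> U"
    unfolding U_def using P Q x by (auto simp: open_Compl closed_path_image closed_Un)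
  obtain r where "r > 0" "ball x r \<subseteq> U" and
    "\<And>z. z \<in> ball x r - path_image (c +++ p) \<Longrightarrow>
       z \<in> left_region (c +++ p) \<longleftrightarrow> (if (1::int) = 1 then z \<in> left_region (c +++ q) else z \<notin> left_region (c +++ q))"
  proof (rule left_region_near[OF p(3) P(5) q(3) Q(5) U, of "\<lambda>z. winding_number p z - winding_number q z" 1])
    show "path_image (c +++ p) \<inter> U = path_image (c +++ q) \<inter> U" using P(4) Q(4) by (auto simp: U_def)
    show "x \<in> path_image (c +++ p)" using x P(4) by auto
    show "isCont (\<lambda>z. winding_number p z - winding_number q z) x"
      using U P Q by (intro continuous_intros continuous_at_winding_number) (auto simp: U_def)
    show "winding_number (c +++ p) z = of_int 1 * winding_number (c +++ q) z + (winding_number p z - winding_number q z)"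
      if "z \<in> U - path_image (c +++ p)" for z
      using that P Q p q by (simp add: winding_number_join U_def arc_imp_path)
  qed auto
  moreover have "ball x r - path_image (c +++ p) = ball x r - path_image c"
    using \<open>ball x r \<subseteq> U\<close> P(4) by (auto simp: U_def)
  ultimately show thesis using that by simp
qed

text \<open>Reversing \<open>c\<close> changes the sign of its contribution, so it is now the sum of
  the two winding numbers in which \<open>c\<close> cancels; hence \<open>s = - 1\<close> and the
  sides are exchanged.\<close>

lemma left_region_closing_reversepath:
  assumes p: "pathstart p = pathfinish c" "pathfinish p = pathstart c" "simple_path (c +++ p)"
    and q: "pathstart q = pathstart c" "pathfinish q = pathfinish c" "simple_path (reversepath c +++ q)"
    and x: "x \<in> path_image c - {pathstart c, pathfinish c}"
  obtains r where "r > 0"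
    "\<And>z. z \<in> ball x r - path_image c \<Longrightarrow> z \<in> left_region (c +++ p) \<longleftrightarrow> z \<notin> left_region (reversepath c +++ q)"
proof -
  have q': "pathstart q = pathfinish (reversepath c)" "pathfinish q = pathstart (reversepath c)" 
    using q by auto
  note P = simple_path_closingD[OF p] and Q = simple_path_closingD[OF q' q(3)]
  define U where "U = - (path_image p \<union> path_image q)"
  have U: "open U" "x \<in> U"
    unfolding U_def using P Q x by (auto simp: open_Compl closed_path_image closed_Un)
  obtain r where "r > 0" "ball x r \<subseteq> U" and
    "\<And>z. z \<in> ball x r - path_image (c +++ p) \<Longrightarrow> z \<in> left_region (c +++ p) \<longleftrightarrow>
       (if (-1::int) = 1 then z \<in> left_region (reversepath c +++ q) else z \<notin> left_region (reversepath c +++ q))"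
  proof (rule left_region_near[OF p(3) P(5) q(3) Q(5) U, of "\<lambda>z. winding_number p z + winding_number q z" "-1"])
    show "path_image (c +++ p) \<inter> U = path_image (reversepath c +++ q) \<inter> U" using P(4) Q(4) by (auto simp: U_def)
    show "x \<in> path_image (c +++ p)" using x P(4) by auto
    show "isCont (\<lambda>z. winding_number p z + winding_number q z) x"
      using U P Q by (intro continuous_intros continuous_at_winding_number) (auto simp: U_def)
    show "winding_number (c +++ p) z = of_int (-1) * winding_number (reversepath c +++ q) z + (winding_number p z + winding_number q z)"
      if "z \<in> U - path_image (c +++ p)" for z
      using that P Q p q by (simp add: winding_number_join winding_number_reversepath U_def arc_imp_path)
  qed auto
  moreover have "ball x r - path_image (c +++ p) = ball x r - path_image c"
    using \<open>ball x r \<subseteq> U\<close> P(4) by (auto simp: U_def)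
  ultimately show thesis using that by simp
qed

context two_connected_plane_graph
begin

section \<open>Faces next to an open edge\<close>

lemma face_disjoint_drawing: "f \<in> faces G \<Longrightarrow> f \<inter> drawing = {}"
  using in_components_subset unfolding faces_eq by blast

lemma open_face: "f \<in> faces G \<Longrightarrow> open f"
  unfolding faces_eq using open_components[of "- drawing" f] closed_drawing by (simp add: open_Compl)

lemma face_eqI: "f \<in> faces G \<Longrightarrow> g \<in> faces G \<Longrightarrow> z \<in> f \<Longrightarrow> z \<in> g \<Longrightarrow> f = g"
  unfolding faces_eq by (rule components_eqI)

definition open_edge :: "'e dart \<Rightarrow> complex set" where
  "open_edge d = img d - {src d, tgt d}"

lemma open_edge_rev_dart [simp]: "open_edge (rev_dart d) = open_edge d"
  by (auto simp: open_edge_def)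

lemma open_edge_eq: "d \<in> darts \<Longrightarrow> open_edge d = dart_curve G d ` {0<..<1}"
  using simple_path_endless[of "dart_curve G d"] arc_dart[of d] by (simp add: open_edge_def arc_imp_simple_path)

lemma open_edge_disjoint:
  assumes "d \<in> darts"
  shows "open_edge d \<inter> vertices G = {}" "d' \<in> darts \<Longrightarrow> fst d' \<noteq> fst d \<Longrightarrow> open_edge d \<inter> img d' = {}"
  using img_Int_vertices[OF assms] img_Int_img[OF assms, of d'] unfolding open_edge_def by auto

text \<open>
  Removing an open edge from the drawing leaves a set that meets a cycle through the edge in an
  arc.  By Janiszewski's theorem each side of the cycle lies, near the edge, in a single face.
\<close>

lemma edge_sides:
  assumes d: "d \<in> darts" and cyc: "cyc (d # xs)"
  obtains L R Q where "L \<in> faces G" "R \<in> faces G" "L \<noteq> R"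
    "open Q" "open_edge d \<subseteq> Q" "Q \<subseteq> open_edge d \<union> L \<union> R"
    "L \<subseteq> left_region (walk_curve G (d # xs))" "R \<inter> left_region (walk_curve G (d # xs)) = {}"
    "open_edge d \<subseteq> closure L" "open_edge d \<subseteq> closure R"
proof -
  define J where "J = walk_curve G (d # xs)"
  define I where "I = open_edge d"
  note cl = cyc_closing[OF cyc]
  have J: "simple_path J" "pathfinish J = pathstart J" "path_image J = img d \<union> support xs"
    using cyc_curve[OF cyc] by (auto simp: J_def)
  have xs: "set xs \<subseteq> darts" "fst d \<notin> fst ` set xs" using cyc by (auto simp: cyc_Cons ipath_def)
  \<comment> \<open>The drawing with the inner points of the edge of \<open>d\<close>
    removed.\<close>
  define H where "H = vertices G \<union> (\<Union>e\<in>edges G - {fst d}. path_image (curve G e))"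
  have "compact H" unfolding H_def
    by (intro compact_Un finite_imp_compact[OF finite_vertices] compact_UN finite_Diff finite_edges
        compact_path_image arc_imp_path arc_curve) simp
  have IH: "I \<inter> H = {}"
  proof -
    have "I \<inter> path_image (curve G e) = {}" if "e \<in> edges G - {fst d}" for e
      using open_edge_disjoint(2)[OF d, of "(e, True)"] that by (auto simp: I_def)
    then show ?thesis using open_edge_disjoint(1)[OF d] by (auto simp: H_def I_def)
  qed
  have DH: "drawing = H \<union> img d" using d by (auto simp: drawing_def H_def in_darts)
  have ends: "{src d, tgt d} \<subseteq> support xs" using cl(8) by blast
  have HI: "img d \<inter> H \<subseteq> {src d, tgt d}" using IH by (auto simp: I_def open_edge_def)
  have supH: "support xs \<subseteq> H"
  proof (rule UN_least)
    fix a assume a: "a \<in> set xs"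
    then have "fst a \<in> edges G - {fst d}"
      using subsetD[OF xs(1) a] xs(2) by (metis DiffI imageI in_darts singletonD)
    then show "img a \<subseteq> H" unfolding H_def by blast
  qed
  \<comment> \<open>What \<open>J\<close> shares with \<open>H\<close> is the rest of the cycle. It
    is an arc, hence connected, which is the hypothesis of Janiszewski's theorem.\<close>
  have JH: "path_image J \<inter> H = support xs"
    using HI ends supH unfolding J(3) by blast
  have sp: "simple_path (dart_curve G d)" using arc_dart[OF d] arc_imp_simple_path by blast
  have "connected I" using connected_simple_path_endless[OF sp] by (simp add: I_def open_edge_def)
  have "I \<noteq> {}" using simple_path_endless[OF sp] by (simp add: I_def open_edge_def)
  then obtain x where x: "x \<in> I" by blast
  \<comment> \<open>A single open set around the whole open edge; inside it, the drawing consists of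
    inner points of that edge only.\<close>
  define Q where "Q = connected_component_set (- H) x"
  have Q: "open Q" "Q \<inter> H = {}"
    using connected_component_subset[of "- H" x] \<open>compact H\<close>
    by (auto simp: Q_def compact_imp_closed open_Compl open_connected_component)
  have IQ: "I \<subseteq> Q"
    unfolding Q_def using x IH \<open>connected I\<close> by (intro connected_component_maximal) auto
  have IJ: "I \<subseteq> path_image J" unfolding J(3) by (auto simp: I_def open_edge_def)
  define side where "side b = (if b then left_region J else - path_image J - left_region J)" for b
  have side: "side b \<in> components (- path_image J)" for b
    using sides_in_components[OF J(1,2)] by (simp add: side_def)
  have near: "U \<inter> side b \<noteq> {}" if "y \<in> I" "open U" "y \<in> U" for y U b
    using both_sides_near[OF J(1,2) _ that(2,3)] that(1) IJ by (auto simp: side_def)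
  \<comment> \<open>Two such points are joined off \<open>J\<close> because they lie on one side of
    it, and off \<open>H\<close> because \<open>Q\<close> is a component of its complement.
    Janiszewski's theorem joins them off both.\<close>
  have joined: "connected_component (- drawing) y z"
    if "y \<in> Q \<inter> side b" "z \<in> Q \<inter> side b" for y z b
  proof -
    have "connected_component (- path_image J) y z"
      using that in_components_connected[OF side] in_components_subset[OF side]
      unfolding connected_component_def by blast
    moreover have "connected_component (- H) y z"
      using that unfolding Q_def by (auto intro: connected_component_sym connected_component_trans)
    moreover have "connected (path_image J \<inter> H)"
      unfolding JH cl(5)[symmetric] using cl(7) by (simp add: connected_arc_image)
    ultimately have "connected_component (- (path_image J \<union> H)) y z"
      using \<open>compact H\<close> J(1) by (intro Janiszewski) (auto simp: compact_imp_closed compact_simple_path_image)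
    moreover have "path_image J \<union> H = drawing" using DH J(3) supH by blast
    ultimately show ?thesis by simp
  qed
  have "{src d, tgt d} \<subseteq> H" using ends supH by (rule subset_trans)
  then have QD: "Q \<inter> drawing \<subseteq> I" using Q(2) unfolding DH I_def open_edge_def by blast
  have sideI: "side b \<inter> path_image J = {}" for b using in_components_subset[OF side] by blast
  have "\<exists>w. w \<in> Q \<inter> side b" for b using near[OF x Q(1)] IQ x by blast
  then obtain w where w: "w b \<in> Q \<inter> side b" for b by metis
  define F where "F b = connected_component_set (- drawing) (w b)" for b
  have wD: "w b \<notin> drawing" for b using w[of b] QD IJ sideI[of b] by blast
  have F: "F b \<in> faces G" "w b \<in> F b" for b
    using wD[of b] by (auto simp: F_def faces_eq intro: componentsI)
  have QF: "Q \<inter> side b \<subseteq> F b" for b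
    using joined[OF w] by (auto simp: F_def)
  have "path_image J \<subseteq> drawing" using J(3) DH supH by blast
  then have F_side: "F b \<subseteq> side b" for b
    using components_maximal[OF side[of b], of "F b"] w[of b] F(2)[of b]
      connected_component_subset[of "- drawing" "w b"] unfolding F_def by blast
  have clF: "I \<subseteq> closure (F b)" for b
  proof
    fix y assume y: "y \<in> I"
    have "U \<inter> F b \<noteq> {}" if "open U" "y \<in> U" for U
      using near[OF y, of "U \<inter> Q" b] that y IQ Q(1) QF[of b] by blast
    then show "y \<in> closure (F b)" by (auto simp: closure_iff_nhds_not_empty)
  qed
  show thesis
  proof (rule that[of "F True" "F False" Q])
    show "F True \<subseteq> left_region (walk_curve G (d # xs))" "F False \<inter> left_region (walk_curve G (d # xs)) = {}"
      using F_side[of True] F_side[of False] by (auto simp: side_def J_def)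
    show "F True \<noteq> F False" using F(2)[of True] F_side[of False] F_side[of True] by (auto simp: side_def)
    show "Q \<subseteq> open_edge d \<union> F True \<union> F False"
    proof
      fix z assume z: "z \<in> Q"
      have "z \<in> side (z \<in> left_region J)" if "z \<notin> I"
        using that z QD \<open>path_image J \<subseteq> drawing\<close> by (auto simp: side_def)
      then show "z \<in> open_edge d \<union> F True \<union> F False"
        using QF z by (cases "z \<in> left_region J") (auto simp: I_def)
    qed
  qed (use F clF Q(1) IQ in \<open>auto simp: I_def\<close>)
qed

lemma left_ofE:
  assumes "left_of G f d" "d \<in> darts"
  obtains p x where "pathstart p = tgt d" "pathfinish p = src d" "simple_path (dart_curve G d +++ p)"
    "x \<in> open_edge d" "x \<in> closure (f \<inter> left_region (dart_curve G d +++ p))"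
  using assms open_edge_eq[OF assms(2)] unfolding left_of_def by (metis imageI)

lemma left_ofI:
  assumes "incident G f (fst d)" "pathstart p = tgt d" "pathfinish p = src d" "simple_path (dart_curve G d +++ p)"
    "x \<in> open_edge d" "d \<in> darts" "x \<in> closure (f \<inter> left_region (dart_curve G d +++ p))"
  shows "left_of G f d"
proof -
  obtain t where t: "t \<in> {0<..<1}" "x = dart_curve G d t" using assms(5) open_edge_eq[OF assms(6)] by auto
  show ?thesis
    unfolding left_of_def using assms(1-4) t(1) assms(7)[unfolded t(2)]
    by (intro conjI exI[of _ p] exI[of _ t])
qed

text \<open>\<open>left_of\<close> accepts any closing arc. The rest of the cycle is one, which puts
  \<open>L\<close> on the left of \<open>d\<close>; every other arc has the same left side near an
  inner point of the edge, which excludes all other faces. For \<open>R\<close> the edge and the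
  closing arc are both reversed.\<close>

lemma edge_faces:
  assumes d: "d \<in> darts" and cyc: "cyc (d # xs)"
  obtains L R Q where "L \<in> faces G" "R \<in> faces G" "L \<noteq> R"
    "open Q" "open_edge d \<subseteq> Q" "Q \<subseteq> open_edge d \<union> L \<union> R"
    "L \<subseteq> left_region (walk_curve G (d # xs))" "R \<inter> left_region (walk_curve G (d # xs)) = {}"
    "open_edge d \<subseteq> closure L" "open_edge d \<subseteq> closure R"
    "\<And>f. f \<in> faces G \<Longrightarrow> incident G f (fst d) \<longleftrightarrow> f = L \<or> f = R"
    "\<And>f. f \<in> faces G \<Longrightarrow> left_of G f d \<longleftrightarrow> f = L"
    "\<And>f. f \<in> faces G \<Longrightarrow> left_of G f (rev_dart d) \<longleftrightarrow> f = R"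
proof (rule edge_sides[OF assms])
  fix L R Q
  let ?c = "dart_curve G d" and ?p = "walk_curve G xs"
  note cl = cyc_closing[OF cyc]
  assume LR: "L \<in> faces G" "R \<in> faces G" "L \<noteq> R"
    and Q: "open Q" "open_edge d \<subseteq> Q" "Q \<subseteq> open_edge d \<union> L \<union> R"
    and left: "L \<subseteq> left_region (walk_curve G (d # xs))" "R \<inter> left_region (walk_curve G (d # xs)) = {}"
    and closure: "open_edge d \<subseteq> closure L" "open_edge d \<subseteq> closure R"
  have left': "L \<subseteq> left_region (?c +++ ?p)" "R \<inter> left_region (?c +++ ?p) = {}"
    using left by (simp_all add: cl(2))
  have sp: "simple_path ?c" using arc_dart[OF d] arc_imp_simple_path by blast
  have "open_edge d \<noteq> {}" by (simp add: open_edge_eq[OF d])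
  then obtain x where x: "x \<in> open_edge d" by blast
  have x': "x \<in> path_image ?c - {src d, tgt d}" if "x \<in> open_edge d" for x
    using that by (simp add: open_edge_def)
  have disj: "f \<inter> img d = {}" if "f \<in> faces G" for f
    using face_disjoint_drawing[OF that] img_subset_drawing[OF d] by blast
  have img_closure: "img d \<subseteq> closure (open_edge d)"
    using path_image_subset_closure_endless[OF sp] by (simp add: open_edge_def)
  have inc: "incident G f (fst d)" if "f = L \<or> f = R" for f
  proof -
    have "f \<in> faces G" "open_edge d \<subseteq> closure f" using that LR closure by auto
    then have "img d \<subseteq> closure f" using img_closure closure_minimal[of "open_edge d" "closure f"] by auto
    then show ?thesis
      using disj[OF \<open>f \<in> faces G\<close>] open_face[OF \<open>f \<in> faces G\<close>]
      by (auto simp: incident_def frontier_def interior_open)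
  qed
  have near: "f = L \<or> f = R" if f: "f \<in> faces G" "x \<in> closure f" "x \<in> open_edge d" for f x
  proof -
    obtain z where z: "z \<in> Q" "z \<in> f"
      using f Q(2) open_Int_closure_eq_empty[OF Q(1), of f] by blast
    then have "z \<notin> open_edge d" using disj[OF f(1)] by (auto simp: open_edge_def)
    then show ?thesis using z Q(3) face_eqI[OF f(1) LR(1)] face_eqI[OF f(1) LR(2)] by blast
  qed
  have sideD: "z \<in> L \<longleftrightarrow> z \<in> left_region (?c +++ ?p)" "z \<in> R \<longleftrightarrow> z \<notin> left_region (?c +++ ?p)"
    if "z \<in> Q" "z \<notin> img d" for z
    using that Q(3) left' by (auto simp: open_edge_def)
  show thesis
  proof (rule that[OF LR Q left closure])
    fix f assume f: "f \<in> faces G"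
    show "incident G f (fst d) \<longleftrightarrow> f = L \<or> f = R"
      using inc near[OF f _ x] x unfolding incident_def frontier_def open_edge_def by blast
    show "left_of G f d \<longleftrightarrow> f = L"
    proof
      assume "left_of G f d"
      then obtain q y where q: "pathstart q = tgt d" "pathfinish q = src d" "simple_path (?c +++ q)"
        and y: "y \<in> open_edge d" "y \<in> closure (f \<inter> left_region (?c +++ q))"
        using left_ofE d by metis
      obtain r where r: "r > 0" "\<And>z. z \<in> ball y r - path_image ?c \<Longrightarrow> z \<in> left_region (?c +++ ?p) \<longleftrightarrow> z \<in> left_region (?c +++ q)"
        using left_region_closing_unique[OF cl(3,4,6) q x'[OF y(1)]] by blast
      have "open (ball y r \<inter> Q)" "y \<in> ball y r \<inter> Q" using r Q y by auto
      then obtain z where z: "z \<in> ball y r \<inter> Q" "z \<in> f" "z \<in> left_region (?c +++ q)"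
        using y(2) open_Int_closure_eq_empty[OF \<open>open (ball y r \<inter> Q)\<close>] by blast
      then have "z \<notin> img d" using disj[OF f] by blast
      then have "z \<in> L" using z r(2)[of z] sideD(1)[of z] by simp
      then show "f = L" using face_eqI[OF f LR(1) z(2)] by simp
    next
      assume "f = L"
      then show "left_of G f d"
        using left_ofI[OF inc cl(3,4,6) x d] left'(1) closure(1) x by (simp add: Int_absorb2 subset_iff)
    qed
    show "left_of G f (rev_dart d) \<longleftrightarrow> f = R"
    proof
      assume "left_of G f (rev_dart d)"
      then obtain q y where q: "pathstart q = src d" "pathfinish q = tgt d" "simple_path (reversepath ?c +++ q)"
        and y: "y \<in> open_edge d" "y \<in> closure (f \<inter> left_region (reversepath ?c +++ q))"
        using left_ofE[of f "rev_dart d"] d by auto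
      obtain r where r: "r > 0" "\<And>z. z \<in> ball y r - path_image ?c \<Longrightarrow> z \<in> left_region (?c +++ ?p) \<longleftrightarrow> z \<notin> left_region (reversepath ?c +++ q)"
        using left_region_closing_reversepath[OF cl(3,4,6) q x'[OF y(1)]] by blast
      have "open (ball y r \<inter> Q)" "y \<in> ball y r \<inter> Q" using r Q y by auto
      then obtain z where z: "z \<in> ball y r \<inter> Q" "z \<in> f" "z \<in> left_region (reversepath ?c +++ q)"
        using y(2) open_Int_closure_eq_empty[OF \<open>open (ball y r \<inter> Q)\<close>] by blast
      then have "z \<notin> img d" using disj[OF f] by blast
      then have "z \<in> R" using z r(2)[of z] sideD(2)[of z] by simp
      then show "f = R" using face_eqI[OF f LR(2) z(2)] by simp
    next
      assume fR: "f = R"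
      let ?q = "reversepath ?p"
      have q: "pathstart ?q = src d" "pathfinish ?q = tgt d" using cl by auto
      have "simple_path (reversepath ?c +++ ?q)"
        using arc_dart[OF d] cl(3-5,7,8) by (intro simple_path_join_loop) (auto simp: arc_reversepath)
      note q = q this
      obtain r where r: "r > 0" "\<And>z. z \<in> ball x r - path_image ?c \<Longrightarrow> z \<in> left_region (?c +++ ?p) \<longleftrightarrow> z \<notin> left_region (reversepath ?c +++ ?q)"
        using left_region_closing_reversepath[OF cl(3,4,6) q x'[OF x]] by blast
      have "U \<inter> (R \<inter> left_region (reversepath ?c +++ ?q)) \<noteq> {}" if U: "open U" "x \<in> U" for U
      proof -
        have "open (U \<inter> ball x r)" "x \<in> U \<inter> ball x r" using U r by auto
        then obtain z where z: "z \<in> U \<inter> ball x r" "z \<in> R"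
          using x closure(2) open_Int_closure_eq_empty[OF \<open>open (U \<inter> ball x r)\<close>, of R] by blast
        then have "z \<notin> img d" "z \<notin> left_region (?c +++ ?p)" using disj[OF LR(2)] left'(2) by auto
        then show ?thesis using z r(2)[of z] by auto
      qed
      then have "x \<in> closure (R \<inter> left_region (reversepath ?c +++ ?q))"
        by (auto simp: closure_iff_nhds_not_empty)
      then show "left_of G f (rev_dart d)"
        using left_ofI[of f "rev_dart d" ?q x] inc[of f] q x d fR by simp
    qed
  qed
qed

text \<open>Meaningful for darts, which have exactly one face on their left. The right face is the
  left face of the reversed dart, so every fact about left faces also serves for right
  faces.\<close>

definition lface :: "'e dart \<Rightarrow> complex set" where
  "lface d = (THE f. f \<in> faces G \<and> left_of G f d)"

abbreviation rface :: "'e dart \<Rightarrow> complex set" where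
  "rface d \<equiv> lface (rev_dart d)"

lemma lface_eqI:
  assumes "L \<in> faces G" "\<And>f. f \<in> faces G \<Longrightarrow> left_of G f d \<longleftrightarrow> f = L"
  shows "lface d = L"
  unfolding lface_def using assms by (intro the_equality) auto

lemma edge_lface_rface:
  assumes d: "d \<in> darts" and cyc: "cyc (d # xs)"
  obtains Q where "open Q" "open_edge d \<subseteq> Q" "Q \<subseteq> open_edge d \<union> lface d \<union> rface d"
    "lface d \<subseteq> left_region (walk_curve G (d # xs))" "rface d \<inter> left_region (walk_curve G (d # xs)) = {}"
    "open_edge d \<subseteq> closure (lface d)" "open_edge d \<subseteq> closure (rface d)"
    "lface d \<in> faces G" "lface d \<noteq> rface d"
    "\<And>f. f \<in> faces G \<Longrightarrow> incident G f (fst d) \<longleftrightarrow> f = lface d \<or> f = rface d"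
    "\<And>f. f \<in> faces G \<Longrightarrow> left_of G f d \<longleftrightarrow> f = lface d"
proof (rule edge_faces[OF assms])
  fix L R Q
  assume *: "L \<in> faces G" "R \<in> faces G" "L \<noteq> R"
    "open Q" "open_edge d \<subseteq> Q" "Q \<subseteq> open_edge d \<union> L \<union> R"
    "L \<subseteq> left_region (walk_curve G (d # xs))" "R \<inter> left_region (walk_curve G (d # xs)) = {}"
    "open_edge d \<subseteq> closure L" "open_edge d \<subseteq> closure R"
    "\<And>f. f \<in> faces G \<Longrightarrow> incident G f (fst d) \<longleftrightarrow> f = L \<or> f = R"
    "\<And>f. f \<in> faces G \<Longrightarrow> left_of G f d \<longleftrightarrow> f = L"
    "\<And>f. f \<in> faces G \<Longrightarrow> left_of G f (rev_dart d) \<longleftrightarrow> f = R"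
  have "lface d = L" "rface d = R" using lface_eqI * by auto
  then show thesis using that[of Q] * by simp
qed

lemma
  assumes d: "d \<in> darts"
  shows lface_in_faces: "lface d \<in> faces G" and lface_neq_rface: "lface d \<noteq> rface d"
    and incident_iff: "f \<in> faces G \<Longrightarrow> incident G f (fst d) \<longleftrightarrow> f = lface d \<or> f = rface d"
    and left_of_iff: "f \<in> faces G \<Longrightarrow> left_of G f d \<longleftrightarrow> f = lface d"
proof -
  obtain xs where "cyc (d # xs)" using ex_cyc[OF d] .
  then show "lface d \<in> faces G" "lface d \<noteq> rface d"
    "f \<in> faces G \<Longrightarrow> incident G f (fst d) \<longleftrightarrow> f = lface d \<or> f = rface d"
    "f \<in> faces G \<Longrightarrow> left_of G f d \<longleftrightarrow> f = lface d"
    using edge_lface_rface[OF d] by metis+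
qed

lemma rface_in_faces: "d \<in> darts \<Longrightarrow> rface d \<in> faces G"
  by (simp add: lface_in_faces)

lemma ex_edge_nbhd:
  assumes d: "d \<in> darts"
  shows "\<exists>Q. open Q \<and> open_edge d \<subseteq> Q \<and> Q \<subseteq> open_edge d \<union> lface d \<union> rface d"
proof -
  obtain xs where "cyc (d # xs)" using ex_cyc[OF d] .
  then show ?thesis using edge_lface_rface[OF d] by metis
qed

section \<open>The dual graph is connected\<close>

lemma drawing_cases:
  assumes "z \<in> drawing" "z \<notin> vertices G"
  obtains e where "e \<in> edges G" "z \<in> open_edge (e, True)"
proof -
  obtain e where e: "e \<in> edges G" "z \<in> img (e, True)" using assms by (auto simp: drawing_def)
  then have "(e, True) \<in> darts" by simp
  then show thesis
    using that e assms(2) img_Int_vertices[of "(e, True)"] by (auto simp: open_edge_def)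
qed

text \<open>If faces that share an edge agree on \<open>P\<close>, then faces and open edges can be
  sorted by \<open>P\<close> into two disjoint open sets covering the plane without the vertices.
  Removing finitely many points leaves the plane connected, so one of the two sets is empty.\<close>

lemma faces_induct_adjacent:
  assumes adj: "\<And>d. d \<in> darts \<Longrightarrow> P (lface d) \<longleftrightarrow> P (rface d)"
    and f: "f \<in> faces G" "P f" and g: "g \<in> faces G"
  shows "P g"
proof (rule ccontr)
  assume "\<not> P g"
  have "\<forall>e. \<exists>Q. e \<in> edges G \<longrightarrow> open Q \<and> open_edge (e, True) \<subseteq> Q \<and>
      Q \<subseteq> open_edge (e, True) \<union> lface (e, True) \<union> rface (e, True)"
    using ex_edge_nbhd by auto
  then obtain Q where "\<forall>e. e \<in> edges G \<longrightarrow> open (Q e) \<and> open_edge (e, True) \<subseteq> Q e \<and>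
      Q e \<subseteq> open_edge (e, True) \<union> lface (e, True) \<union> rface (e, True)"
    unfolding choice_iff by blast
  then have Q: "open (Q e)" "open_edge (e, True) \<subseteq> Q e"
      "Q e \<subseteq> open_edge (e, True) \<union> lface (e, True) \<union> rface (e, True)" if "e \<in> edges G" for e
    using that by blast+
  \<comment> \<open>An edge joins the class of its left face, together with a neighbourhood that
    makes the class open; by \<open>adj\<close> its right face is in the same class.\<close>
  define A where "A b = \<Union> {f \<in> faces G. P f = b} \<union> \<Union> (Q ` {e \<in> edges G. P (lface (e, True)) = b})" for b
  have face_A: "P f = b" if z: "z \<in> A b" and f: "f \<in> faces G" "z \<in> f" for z f b
  proof -
    consider f' where "f' \<in> faces G" "P f' = b" "z \<in> f'"
      | e where "e \<in> edges G" "P (lface (e, True)) = b" "z \<in> Q e"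
      using z unfolding A_def by blast
    then show ?thesis
    proof cases
      case 1
      then show ?thesis using face_eqI[OF f(1) _ f(2)] by blast
    next
      case (2 e)
      have e: "(e, True) \<in> darts" using 2 by simp
      have "z \<notin> drawing" using face_disjoint_drawing[OF f(1)] f(2) by blast
      then have "z \<notin> open_edge (e, True)"
        using img_subset_drawing[OF e] by (auto simp: open_edge_def)
      then have "z \<in> lface (e, True) \<or> z \<in> rface (e, True)" using Q(3)[OF 2(1)] 2(3) by blast
      then have "f = lface (e, True) \<or> f = rface (e, True)"
        using face_eqI[OF f(1) lface_in_faces[OF e] f(2)] face_eqI[OF f(1) rface_in_faces[OF e] f(2)] by blast
      then show ?thesis using adj[OF e] 2(2) by auto
    qed
  qed
  have edge_A: "P (lface (e, True)) = b" if z: "z \<in> A b" and e: "e \<in> edges G" "z \<in> open_edge (e, True)" for z e b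
  proof -
    have ed: "(e, True) \<in> darts" using e by simp
    have "z \<in> img (e, True)" using e(2) by (simp add: open_edge_def)
    then have zD: "z \<in> drawing" by (rule subsetD[OF img_subset_drawing[OF ed]])
    then obtain e' where e': "e' \<in> edges G" "P (lface (e', True)) = b" "z \<in> Q e'"
      using z face_disjoint_drawing unfolding A_def by blast
    have ed': "(e', True) \<in> darts" using e' by simp
    have "z \<in> open_edge (e', True)"
      using Q(3)[OF e'(1)] e'(3) zD face_disjoint_drawing[OF lface_in_faces[OF ed']]
        face_disjoint_drawing[OF rface_in_faces[OF ed']] by blast
    then have "e = e'"
      using open_edge_disjoint(2)[OF ed ed'] e(2) by (auto simp: open_edge_def)
    then show ?thesis using e' by simp
  qed
  have "A b \<subseteq> - vertices G" for b
  proof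
    fix z assume z: "z \<in> A b"
    show "z \<in> - vertices G"
    proof
      assume zV: "z \<in> vertices G"
      then have zD: "z \<in> drawing" by (simp add: drawing_def)
      then obtain e where e: "e \<in> edges G" "z \<in> Q e"
        using z face_disjoint_drawing unfolding A_def by blast
      have ed: "(e, True) \<in> darts" using e by simp
      have "z \<in> open_edge (e, True)"
        using Q(3)[OF e(1)] e(2) zD face_disjoint_drawing[OF lface_in_faces[OF ed]]
          face_disjoint_drawing[OF rface_in_faces[OF ed]] by blast
      then show False using open_edge_disjoint(1)[OF ed] zV by blast
    qed
  qed
  moreover have cover: "- vertices G \<subseteq> A True \<union> A False"
  proof
    fix z assume z: "z \<in> - vertices G"
    show "z \<in> A True \<union> A False"
    proof (cases "z \<in> drawing")
      case True
      then obtain e where e: "e \<in> edges G" "z \<in> open_edge (e, True)" using drawing_cases z by blast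
      then have "z \<in> Q e" using Q(2) by blast
      then show ?thesis using e(1) unfolding A_def by (cases "P (lface (e, True))") blast+
    next
      case False
      then have "connected_component_set (- drawing) z \<in> faces G" "z \<in> connected_component_set (- drawing) z"
        by (auto simp: faces_eq intro: componentsI)
      then show ?thesis
        unfolding A_def by (cases "P (connected_component_set (- drawing) z)") blast+
    qed
  qed
  moreover have "A True \<inter> A False \<inter> - vertices G = {}"
  proof -
    have False if z: "z \<in> A True" "z \<in> A False" "z \<notin> vertices G" for z
    proof (cases "z \<in> drawing")
      case True
      then obtain e where "e \<in> edges G" "z \<in> open_edge (e, True)" using drawing_cases z(3) by blast
      then show False using edge_A[OF z(1)] edge_A[OF z(2)] by blast
    next
      case False
      then have "connected_component_set (- drawing) z \<in> faces G" "z \<in> connected_component_set (- drawing) z"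
        by (auto simp: faces_eq intro: componentsI)
      then show False using face_A[OF z(1)] face_A[OF z(2)] by blast
    qed
    then show ?thesis by blast
  qed
  moreover have op: "open (A b)" for b
    unfolding A_def using open_face Q(1) by (intro open_Un open_Union open_UN) auto
  moreover have "connected (- vertices G)"
    using path_connected_complement_countable[of "vertices G"] finite_vertices
    by (simp add: path_connected_imp_connected countable_finite)
  ultimately have "A True \<inter> - vertices G = {} \<or> A False \<inter> - vertices G = {}"
    using connectedD[of "- vertices G" "A True" "A False"] by blast
  moreover have "f \<noteq> {}" "g \<noteq> {}" using f g in_components_nonempty unfolding faces_eq by blast+
  moreover have "f \<subseteq> A True" "g \<subseteq> A False" using f g \<open>\<not> P g\<close> unfolding A_def by blast+
  ultimately show False using \<open>\<And>b. A b \<subseteq> - vertices G\<close> by blast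
qed

text \<open>Both faces at an edge are left faces of some dart, so this property passes across every
  edge and spreads from one face to all.\<close>

lemma face_eq_lface:
  assumes "f \<in> faces G"
  obtains d where "d \<in> darts" "f = lface d"
proof -
  have "f \<in> lface ` darts"
  proof -
    obtain e where e: "e \<in> edges G" using edges_nonempty by blast
    then have ed: "(e, True) \<in> darts" by simp
    have "d \<in> darts \<Longrightarrow> lface d \<in> lface ` darts \<longleftrightarrow> rface d \<in> lface ` darts" for d by simp
    then show ?thesis
      using faces_induct_adjacent[of "\<lambda>f. f \<in> lface ` darts" "lface (e, True)" f] lface_in_faces[OF ed] ed assms by simp
  qed
  then show thesis using that by blast
qed

section \<open>Finitely many faces, exactly one of them unbounded\<close>

lemma finite_faces: "finite (faces G)"
proof -
  have "faces G \<subseteq> lface ` darts" using face_eq_lface by blast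
  moreover have "finite darts" by (simp add: darts_def finite_edges)
  ultimately show ?thesis using finite_subset by blast
qed

lemma outer_face_in_faces: "outer_face G \<in> faces G"
  and unbounded_face_iff: "f \<in> faces G \<Longrightarrow> \<not> bounded f \<longleftrightarrow> f = outer_face G"
proof -
  have b: "bounded (- (- drawing))" using compact_drawing compact_imp_bounded by simp
  obtain F where F: "F \<in> faces G" "\<not> bounded F"
    using cobounded_unbounded_components[OF b] unfolding faces_eq by blast
  have unique: "f = F" if "f \<in> faces G" "\<not> bounded f" for f
    using cobounded_unique_unbounded_components[OF b, of F f] F that unfolding faces_eq by simp
  have o: "outer_face G = F" 
    unfolding outer_face_def by (rule the_equality) (use F unique in blast)+
  show "outer_face G \<in> faces G" using o F by simp
  show "\<not> bounded f \<longleftrightarrow> f = outer_face G" if "f \<in> faces G" using o F unique that by blast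
qed

section \<open>Circulations and face potentials\<close>

text \<open>Kirchhoff's law in tested form: taking the indicator of a vertex as
  \<open>\<phi>\<close> gives the balance at that vertex. The form with arbitrary
  \<open>\<phi>\<close> applies directly to the logarithms in
  \<open>winding_sum_Ints\<close>.\<close>

definition circulation :: "('e \<Rightarrow> int) \<Rightarrow> bool" where
  "circulation n \<longleftrightarrow> (\<forall>\<phi> :: complex \<Rightarrow> complex.
     (\<Sum>e\<in>edges G. of_int (n e) * (\<phi> (pathfinish (curve G e)) - \<phi> (pathstart (curve G e)))) = 0)"

definition winding_sum :: "('e \<Rightarrow> int) \<Rightarrow> complex \<Rightarrow> complex" where
  "winding_sum n z = (\<Sum>e\<in>edges G. of_int (n e) * winding_number (curve G e) z)"

lemma notin_curve: "z \<notin> drawing \<Longrightarrow> e \<in> edges G \<Longrightarrow> z \<notin> path_image (curve G e)"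
  by (auto simp: drawing_def)

text \<open>
  Modulo integers, the winding number of an arc about \<open>z\<close> is a difference of logarithms of
  \<open>v - z\<close> at its end points \<open>v\<close>; such differences cancel in a circulation.
\<close>

lemma winding_sum_Ints:
  assumes n: "circulation n" and z: "z \<notin> drawing"
  shows "winding_sum n z \<in> \<int>"
proof -
  define \<phi> where "\<phi> v = Ln (v - z) / (2 * pi * \<i>)" for v
  have "\<exists>k. winding_number (curve G e) z = \<phi> (pathfinish (curve G e)) - \<phi> (pathstart (curve G e)) + of_int k"
    if e: "e \<in> edges G" for e
  proof -
    let ?c = "curve G e" and ?w = "winding_number (curve G e) z"
    have zc: "z \<notin> path_image ?c" using notin_curve[OF z e] .
    then have ne: "pathfinish ?c - z \<noteq> 0" "pathstart ?c - z \<noteq> 0" by auto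
    have "exp (Ln (pathfinish ?c - z)) = exp (2 * pi * \<i> * ?w + Ln (pathstart ?c - z))"
      using winding_number_exp_2pi[OF arc_imp_path[OF arc_curve[OF e]] zc] ne by (simp add: exp_add)
    \<comment> \<open>The integer \<open>k\<close> accounts for the branch of the logarithm.\<close>
    then obtain k :: int where k: "Ln (pathfinish ?c - z) = 2 * pi * \<i> * ?w + Ln (pathstart ?c - z) + (of_int (2 * k) * pi) * \<i>"
      unfolding exp_eq by blast
    then have "\<phi> (pathfinish ?c) = ?w + \<phi> (pathstart ?c) + of_int k"
      unfolding \<phi>_def by (simp add: field_simps)
    then have "?w = \<phi> (pathfinish ?c) - \<phi> (pathstart ?c) + of_int (- k)" by simp
    then show ?thesis by blast
  qed
  then obtain k where k: "\<And>e. e \<in> edges G \<Longrightarrow>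
      winding_number (curve G e) z = \<phi> (pathfinish (curve G e)) - \<phi> (pathstart (curve G e)) + of_int (k e)"
    by metis
  have "winding_sum n z = (\<Sum>e\<in>edges G. of_int (n e) * (\<phi> (pathfinish (curve G e)) - \<phi> (pathstart (curve G e))))
      + (\<Sum>e\<in>edges G. of_int (n e * k e))"
    unfolding winding_sum_def by (simp add: k distrib_left sum.distrib)
  also have "\<dots> = of_int (\<Sum>e\<in>edges G. n e * k e)"
    using n unfolding circulation_def by simp
  finally show ?thesis by (simp only: Ints_of_int)
qed

lemma isCont_winding_sum:
  assumes "finite E" "\<And>e. e \<in> E \<Longrightarrow> e \<in> edges G \<and> z \<notin> path_image (curve G e)"
  shows "isCont (\<lambda>z. \<Sum>e\<in>E. of_int (n e) * winding_number (curve G e) z) z"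
  using assms by (intro continuous_intros continuous_at_winding_number) (auto simp: arc_curve arc_imp_path)

text \<open>A continuous function with integer values is constant on a connected set.\<close>

lemma winding_sum_constant:
  assumes n: "circulation n" and f: "f \<in> faces G" and zw: "z \<in> f" "w \<in> f"
  shows "winding_sum n z = winding_sum n w"
proof -
  have D: "f \<inter> drawing = {}" using face_disjoint_drawing[OF f] .
  have "winding_sum n constant_on f"
  proof (rule continuous_discrete_range_constant)
    show "connected f" using f in_components_connected unfolding faces_eq by blast
    show "continuous_on f (winding_sum n)"
      unfolding winding_sum_def using D notin_curve finite_edges
      by (intro continuous_at_imp_continuous_on ballI isCont_winding_sum) blast+
    show "\<exists>e>0. \<forall>y. y \<in> f \<and> winding_sum n y \<noteq> winding_sum n x \<longrightarrow> e \<le> norm (winding_sum n y - winding_sum n x)"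
      if x: "x \<in> f" for x
    proof (intro exI[of _ 1] conjI allI impI)
      fix y assume y: "y \<in> f \<and> winding_sum n y \<noteq> winding_sum n x"
      then obtain a b where ab: "winding_sum n y = of_int a" "winding_sum n x = of_int b"
        using winding_sum_Ints[OF n] D x by (metis Ints_cases disjoint_iff)
      then have "1 \<le> \<bar>a - b\<bar>" using y by auto
      then have "1 \<le> real_of_int \<bar>a - b\<bar>" by (simp only: of_int_1_le_iff)
      then show "1 \<le> norm (winding_sum n y - winding_sum n x)"
        unfolding ab by (simp only: norm_of_int of_int_abs flip: of_int_diff)
    qed simp
  qed
  then show ?thesis using zw by (auto simp: constant_on_def)
qed

definition face_winding :: "('e \<Rightarrow> int) \<Rightarrow> complex set \<Rightarrow> int" where
  "face_winding n f = (THE k. \<forall>z\<in>f. winding_sum n z = of_int k)"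

lemma face_winding:
  assumes n: "circulation n" and f: "f \<in> faces G" and z: "z \<in> f"
  shows "winding_sum n z = of_int (face_winding n f)"
proof -
  obtain k where "winding_sum n z = of_int k"
    using winding_sum_Ints[OF n] face_disjoint_drawing[OF f] z by (metis Ints_cases disjoint_iff)
  then have k: "\<forall>z\<in>f. winding_sum n z = of_int k" using winding_sum_constant[OF n f z] by metis
  then have "face_winding n f = k"
    unfolding face_winding_def using z by (intro the_equality) auto
  then show ?thesis using k z by simp
qed

definition dart_sign :: "'e dart \<Rightarrow> int" where
  "dart_sign d = (if snd d then 1 else - 1)"

lemma winding_number_dart:
  assumes "d \<in> darts" "z \<notin> img d"
  shows "winding_number (dart_curve G d) z = of_int (dart_sign d) * winding_number (curve G (fst d)) z"
  using assms arc_curve[of "fst d"]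
  by (simp add: dart_curve_def dart_sign_def winding_number_reversepath arc_imp_path in_darts)

text \<open>Near an inner point of the edge, \<open>winding_sum n\<close> is \<open>s\<close> times
  the winding number of a cycle through \<open>d\<close> plus a continuous remainder. The winding
  number of the cycle jumps by 1 from right to left, so the jump of the sum differs from
  \<open>s\<close> by an integer of absolute value less than 1.\<close>

lemma face_winding_jump:
  assumes n: "circulation n" and d: "d \<in> darts"
  shows "face_winding n (lface d) - face_winding n (rface d) = dart_sign d * n (fst d)"
proof -
  obtain xs where cyc: "cyc (d # xs)" using ex_cyc[OF d] .
  define J where "J = walk_curve G (d # xs)"
  define s where "s = dart_sign d * n (fst d)"
  note cl = cyc_closing[OF cyc]
  note J = cyc_curve[OF cyc, folded J_def]
  have sides: "lface d \<subseteq> left_region J" "rface d \<inter> left_region J = {}"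
    "open_edge d \<subseteq> closure (lface d)" "open_edge d \<subseteq> closure (rface d)"
    using edge_lface_rface[OF d cyc] unfolding J_def by metis+
  have L: "lface d \<in> faces G" and R: "rface d \<in> faces G" using d by (simp_all add: lface_in_faces)
  have JD: "path_image J \<subseteq> drawing"
    using support_subset_drawing[of "d # xs"] cyc unfolding J(3) by (simp add: cyc_def)
  have "open_edge d \<noteq> {}" by (simp add: open_edge_eq[OF d])
  then obtain x where x: "x \<in> open_edge d" by blast
  \<comment> \<open>What is left after the edge of \<open>d\<close> has been completed to
    \<open>J\<close>: the other edges, less the closing arc with weight \<open>s\<close>. None of
    these curves passes through \<open>x\<close>.\<close>
  define h where "h z = (\<Sum>e\<in>edges G - {fst d}. of_int (n e) * winding_number (curve G e) z)
    - of_int s * winding_number (walk_curve G xs) z" for z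
  have "isCont h x"
  proof -
    have "x \<notin> path_image (curve G e)" if "e \<in> edges G - {fst d}" for e
      using open_edge_disjoint(2)[OF d, of "(e, True)"] that x by auto
    moreover have "x \<notin> path_image (walk_curve G xs)"
      using cl(5,8) x by (auto simp: open_edge_def)
    ultimately show ?thesis
      unfolding h_def using finite_edges cl(7)
      by (intro continuous_intros isCont_winding_sum continuous_at_winding_number)
        (auto simp: arc_imp_path)
  qed
  then obtain r where r: "r > 0" "\<And>z. dist z x < r \<Longrightarrow> dist (h z) (h x) < 1/2"
    unfolding continuous_at_eps_delta by (metis half_gt_zero_iff zero_less_one)
  have decomp: "winding_sum n z = of_int s * winding_number J z + h z" if z: "z \<notin> drawing" for z
  proof -
    have zd: "z \<notin> img d" "z \<notin> support xs" using z JD J(3) by auto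
    have "winding_number J z = winding_number (dart_curve G d) z + winding_number (walk_curve G xs) z"
      unfolding J_def cl(2) using zd path_dart[OF d] cl(3,5,7)
      by (intro winding_number_join) (auto simp: arc_imp_path)
    moreover have "winding_sum n z = of_int (n (fst d)) * winding_number (curve G (fst d)) z
        + (\<Sum>e\<in>edges G - {fst d}. of_int (n e) * winding_number (curve G e) z)"
      unfolding winding_sum_def using finite_edges d by (intro sum.remove) (auto simp: in_darts)
    ultimately show ?thesis
      using winding_number_dart[OF d zd(1)] by (simp add: h_def s_def dart_sign_def algebra_simps)
  qed
  have approach: "\<exists>z\<in>f. dist z x < r" if "x \<in> closure f" for f
    using that r(1) by (meson closure_approachable)
  obtain zl where zl: "zl \<in> lface d" "dist zl x < r" using approach sides(3) x by blast
  obtain zr where zr: "zr \<in> rface d" "dist zr x < r" using approach sides(4) x by blast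
  have nD: "zl \<notin> drawing" "zr \<notin> drawing"
    using face_disjoint_drawing[OF L] face_disjoint_drawing[OF R] zl zr by blast+
  then have nJ: "zl \<notin> path_image J" "zr \<notin> path_image J" using JD by blast+
  have "winding_number J zl - winding_number J zr = 1"
    using winding_number_left_region[OF J(1,2)] nJ sides(1,2) zl(1) zr(1) by auto
  then have W: "winding_number J zl = winding_number J zr + 1" by (simp add: algebra_simps)
  have "of_int (face_winding n (lface d)) - of_int (face_winding n (rface d)) - of_int s = h zl - h zr"
    unfolding face_winding[OF n L zl(1), symmetric] face_winding[OF n R zr(1), symmetric]
      decomp[OF nD(1)] decomp[OF nD(2)] W
    by (simp add: algebra_simps)
  moreover have "norm (h zl - h zr) < 1"
    using dist_triangle_half_r[of "h x" "h zl" 1 "h zr"] r(2)[OF zl(2)] r(2)[OF zr(2)]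
    by (simp add: dist_commute flip: dist_norm)
  ultimately have "norm (complex_of_int (face_winding n (lface d) - face_winding n (rface d) - s)) < 1"
    by simp
  then have "\<bar>face_winding n (lface d) - face_winding n (rface d) - s\<bar> < 1"
    by (simp only: norm_of_int of_int_less_1_iff flip: of_int_abs)
  then show ?thesis by (simp add: s_def)
qed

section \<open>Potentials of the difference of two orientations\<close>

lemma finite_darts: "finite darts"
  by (simp add: darts_def finite_edges)

text \<open>Every edge is covered twice, once per direction. For orientations the two conditions
  agree, since reversing the dart changes the sign of both sides.\<close>

definition difference_potential :: "'e dart set \<Rightarrow> 'e dart set \<Rightarrow> (complex set \<Rightarrow> int) \<Rightarrow> bool" where
  "difference_potential D' D z \<longleftrightarrow> z (outer_face G) = 0 \<and>
     (\<forall>d\<in>darts. z (lface d) - z (rface d) = of_bool (d \<in> D') - of_bool (d \<in> D))"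

lemma orientationD:
  assumes "orientation G D"
  shows "D \<subseteq> darts" "d \<in> darts \<Longrightarrow> rev_dart d \<in> D \<longleftrightarrow> d \<notin> D"
proof -
  show "D \<subseteq> darts" using assms by (simp add: orientation_def darts_def)
  assume "d \<in> darts"
  then show "rev_dart d \<in> D \<longleftrightarrow> d \<notin> D"
    using assms by (cases d; cases "snd d") (auto simp: orientation_def rev_dart_def)
qed

lemma left_of_darts_iff:
  assumes d: "d \<in> darts"
  shows "(\<exists>d'\<in>F. fst d' = fst d \<and> left_of G (lface d) d') \<longleftrightarrow> d \<in> F"
    and "(\<exists>d'\<in>F. fst d' = fst d \<and> left_of G (rface d) d') \<longleftrightarrow> rev_dart d \<in> F"
proof -
  have r: "rev_dart d \<in> darts" using d by simp
  have l: "left_of G (lface d) d" "\<not> left_of G (lface d) (rev_dart d)"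
    "\<not> left_of G (rface d) d" "left_of G (rface d) (rev_dart d)"
    using left_of_iff[OF d] left_of_iff[OF r] lface_in_faces[OF d] lface_in_faces[OF r] lface_neq_rface[OF d]
    by auto
  have *: "(\<exists>d'\<in>F. fst d' = fst d \<and> left_of G f d') \<longleftrightarrow>
      d \<in> F \<and> left_of G f d \<or> rev_dart d \<in> F \<and> left_of G f (rev_dart d)" for f
    using fst_eq_dart[of _ d] by auto
  show "(\<exists>d'\<in>F. fst d' = fst d \<and> left_of G (lface d) d') \<longleftrightarrow> d \<in> F"
    "(\<exists>d'\<in>F. fst d' = fst d \<and> left_of G (rface d) d') \<longleftrightarrow> rev_dart d \<in> F"
    unfolding * using l by simp_all
qed

text \<open>Two different faces incident with an edge are its left and right face, so a condition on
  pairs of faces becomes one on darts. With the left face as \<open>f2\<close>, the first test asks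
  whether \<open>d\<close> is in \<open>D' - D\<close> and the second whether
  \<open>rev_dart d\<close> is, that is, whether \<open>d\<close> is in
  \<open>D - D'\<close>.\<close>

lemma is_potential_iff:
  assumes D': "orientation G D'" and D: "orientation G D"
  shows "is_potential G (D' - D) z \<longleftrightarrow> difference_potential D' D z"
proof -
  let ?F = "D' - D"
  let ?jump = "\<lambda>f1 f2 e. z f2 = (if \<exists>d\<in>?F. fst d = e \<and> left_of G f2 d then z f1 + 1
                else if \<exists>d\<in>?F. fst d = e \<and> left_of G f1 d then z f1 - 1 else z f1)"
  have jump: "?jump (rface d) (lface d) (fst d) \<longleftrightarrow> z (lface d) - z (rface d) = of_bool (d \<in> D') - of_bool (d \<in> D)"
    if d: "d \<in> darts" for d
    using orientationD(2)[OF D' d] orientationD(2)[OF D d] by (auto simp: left_of_darts_iff[OF d])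
  show ?thesis
  proof
    assume z: "is_potential G ?F z"
    have "?jump (rface d) (lface d) (fst d)" if d: "d \<in> darts" for d
      using z incident_iff[OF d] lface_in_faces[OF d] rface_in_faces[OF d] lface_neq_rface[OF d] d
      unfolding is_potential_def in_darts by metis
    then show "difference_potential D' D z"
      using z jump by (auto simp: difference_potential_def is_potential_def)
  next
    assume z: "difference_potential D' D z"
    have "?jump f1 f2 e" if f: "f1 \<in> faces G" "f2 \<in> faces G" and e: "e \<in> edges G"
      and inc: "f1 \<noteq> f2" "incident G f1 e" "incident G f2 e" for f1 f2 e
    proof -
      have d: "(e, b) \<in> darts" for b using e by simp
      have "f2 = lface (e, True) \<and> f1 = rface (e, True) \<or> f1 = lface (e, True) \<and> f2 = rface (e, True)"
        using incident_iff[OF d[of True]] f inc by auto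
      \<comment> \<open>The direction of the edge is chosen so that \<open>f2\<close> is on its
        left.\<close>
      then have "\<exists>b. f2 = lface (e, b) \<and> f1 = rface (e, b)"
      proof
        assume "f1 = lface (e, True) \<and> f2 = rface (e, True)"
        then show ?thesis by (intro exI[of _ False]) (simp add: rev_dart_def)
      qed blast
      then obtain b where b: "f2 = lface (e, b)" "f1 = rface (e, b)" by blast
      have "z (lface (e, b)) - z (rface (e, b)) = of_bool ((e, b) \<in> D') - of_bool ((e, b) \<in> D)"
        using z d[of b] unfolding difference_potential_def by blast
      then show ?thesis unfolding b using jump[OF d[of b]] unfolding fst_conv by blast
    qed
    then show "is_potential G ?F z"
      using z unfolding is_potential_def difference_potential_def by blast
  qed
qed

lemma difference_potential_unique:
  assumes "difference_potential D' D z" "difference_potential D' D z'" "f \<in> faces G"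
  shows "z f = z' f"
proof (rule faces_induct_adjacent[of "\<lambda>f. z f = z' f" "outer_face G" f])
  fix d assume "d \<in> darts"
  then have "z (lface d) - z (rface d) = z' (lface d) - z' (rface d)"
    using assms by (simp add: difference_potential_def)
  then show "z (lface d) = z' (lface d) \<longleftrightarrow> z (rface d) = z' (rface d)" by auto
qed (use assms outer_face_in_faces in \<open>auto simp: difference_potential_def\<close>)

lemma potential_eq:
  assumes D': "orientation G D'" and D: "orientation G D"
    and z: "difference_potential D' D z" and f: "f \<in> faces G"
  shows "potential G (D' - D) f = z f"
proof -
  define z0 where "z0 f = (if f \<in> faces G then z f else 0)" for f
  have z0: "difference_potential D' D z0"
    using z by (simp add: difference_potential_def z0_def lface_in_faces outer_face_in_faces)
  have "potential G (D' - D) = z0"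
    unfolding potential_def is_potential_iff[OF D' D]
  proof (rule the_equality)
    show "difference_potential D' D z0 \<and> (\<forall>f. f \<notin> faces G \<longrightarrow> z0 f = 0)" using z0 by (simp add: z0_def)
    fix z' assume z': "difference_potential D' D z' \<and> (\<forall>f. f \<notin> faces G \<longrightarrow> z' f = 0)"
    show "z' = z0"
    proof
      fix f show "z' f = z0 f"
        using z' difference_potential_unique[OF _ z0, of z' f] by (cases "f \<in> faces G") (auto simp: z0_def)
    qed
  qed
  then show ?thesis using f by (simp add: z0_def)
qed

text \<open>The right-hand side depends on \<open>D\<close> only through \<open>\<alpha>\<close>.
  Subtracting the identities for two \<open>\<alpha>\<close>-orientations shows that their
  difference is a circulation.\<close>

lemma out_degree_sum:
  assumes "alpha_orientation G \<alpha> D"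
  shows "(\<Sum>e\<in>edges G. of_bool ((e, True) \<in> D) * (\<phi> (pathfinish (curve G e)) - \<phi> (pathstart (curve G e)))) =
    (\<Sum>e\<in>edges G. \<phi> (pathfinish (curve G e))) - (\<Sum>v\<in>vertices G. of_nat (\<alpha> v) * (\<phi> v :: complex))"
proof -
  have D: "orientation G D" "\<And>v. v \<in> vertices G \<Longrightarrow> card {d \<in> D. src d = v} = \<alpha> v"
    using assms by (auto simp: alpha_orientation_def out_degree_def out_arcs_def digraph_of_def)
  have sub: "D \<subseteq> darts" using orientationD(1)[OF D(1)] .
  have fin: "finite D" using finite_subset[OF sub finite_darts] .
  have D_eq: "D = (\<lambda>e. (e, (e, True) \<in> D)) ` edges G"
  proof -
    have "d \<in> (\<lambda>e. (e, (e, True) \<in> D)) ` edges G" if "d \<in> D" for d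
    proof (cases d)
      case (Pair e b)
      then have e: "e \<in> edges G" using that sub by auto
      then have "((e, True) \<in> D) = b"
        using that D(1) Pair by (cases b) (auto simp: orientation_def)
      then show ?thesis using e Pair by auto
    qed
    moreover have "(e, (e, True) \<in> D) \<in> D" if "e \<in> edges G" for e
      using that D(1) by (cases "(e, True) \<in> D") (auto simp: orientation_def)
    ultimately show ?thesis by blast
  qed
  have "(\<Sum>v\<in>vertices G. of_nat (\<alpha> v) * \<phi> v) = (\<Sum>v\<in>vertices G. \<Sum>d\<in>{d \<in> D. src d = v}. \<phi> (src d))"
    using D(2) by (intro sum.cong) auto
  also have "\<dots> = (\<Sum>d\<in>D. \<phi> (src d))"
    using fin finite_vertices src_in_vertices sub by (intro sum.group) auto
  also have "\<dots> = (\<Sum>e\<in>edges G. \<phi> (src (e, (e, True) \<in> D)))"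
    by (subst (1) D_eq, subst sum.reindex) (auto simp: inj_on_def)
  \<comment> \<open>The selected dart starts at the start of the curve if it runs along it, and at
    its finish otherwise.\<close>
  also have "\<dots> = (\<Sum>e\<in>edges G. \<phi> (pathfinish (curve G e)) -
      of_bool ((e, True) \<in> D) * (\<phi> (pathfinish (curve G e)) - \<phi> (pathstart (curve G e))))"
    by (intro sum.cong) (auto simp: dart_curve_def)
  finally show ?thesis by (simp add: sum_subtractf)
qed

lemma ex_difference_potential:
  assumes D': "alpha_orientation G \<alpha> D'" and D: "alpha_orientation G \<alpha> D"
  shows "\<exists>z. difference_potential D' D z"
proof -
  define n :: "'e \<Rightarrow> int" where "n e = of_bool ((e, True) \<in> D') - of_bool ((e, True) \<in> D)" for e
  have n: "circulation n"
    unfolding circulation_def n_def using out_degree_sum[OF D'] out_degree_sum[OF D]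
    by (simp add: left_diff_distrib sum_subtractf)
  have "dart_sign d * n (fst d) = of_bool (d \<in> D') - of_bool (d \<in> D)" if "d \<in> darts" for d
    using that D' D by (cases d; cases "snd d") (auto simp: dart_sign_def n_def alpha_orientation_def orientation_def)
  \<comment> \<open>Subtracting the value at the outer face normalises the potential and leaves all
    jumps unchanged.\<close>
  then have "difference_potential D' D (\<lambda>f. face_winding n f - face_winding n (outer_face G))"
    using face_winding_jump[OF n] by (simp add: difference_potential_def)
  then show ?thesis by blast
qed

section \<open>The dual of a strongly connected orientation is acyclic\<close>

text \<open>The net number of traversals of \<open>e\<close>, counted positively along
  \<open>curve G e\<close>.\<close>

primrec walk_flow :: "'e dart list \<Rightarrow> 'e \<Rightarrow> int" where
  "walk_flow [] e = 0"
| "walk_flow (d # ds) e = (if fst d = e then dart_sign d else 0) + walk_flow ds e"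

lemma sum_walk_flow:
  assumes "set xs \<subseteq> darts" "chain u xs v"
  shows "(\<Sum>e\<in>edges G. of_int (walk_flow xs e) * (\<phi> (pathfinish (curve G e)) - \<phi> (pathstart (curve G e)))) = \<phi> v - (\<phi> u :: complex)"
  using assms
proof (induction xs arbitrary: u)
  case (Cons d xs)
  let ?D = "\<lambda>e. \<phi> (pathfinish (curve G e)) - \<phi> (pathstart (curve G e))"
  have "(\<Sum>e\<in>edges G. of_int (walk_flow (d # xs) e) * ?D e) =
      (\<Sum>e\<in>edges G. if fst d = e then of_int (dart_sign d) * ?D e else 0) + (\<Sum>e\<in>edges G. of_int (walk_flow xs e) * ?D e)"
    unfolding sum.distrib[symmetric] by (intro sum.cong) (auto simp: algebra_simps)
  also have "(\<Sum>e\<in>edges G. if fst d = e then of_int (dart_sign d) * ?D e else 0) = of_int (dart_sign d) * ?D (fst d)"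
    using Cons.prems finite_edges by (simp add: in_darts)
  also have "\<dots> = \<phi> (tgt d) - \<phi> (src d)" by (simp add: dart_sign_def dart_curve_def)
  also have "(\<Sum>e\<in>edges G. of_int (walk_flow xs e) * ?D e) = \<phi> v - \<phi> (tgt d)"
    using Cons.IH[of "tgt d"] Cons.prems by simp
  finally show ?case using Cons.prems by simp
qed simp

text \<open>A walk inside an orientation traverses each edge in one direction only, so no
  cancellation occurs: the product is the number of occurrences of \<open>d\<close>.\<close>

lemma walk_flow_nonneg:
  assumes "orientation G D" "set xs \<subseteq> D" "d \<in> D"
  shows "0 \<le> dart_sign d * walk_flow xs (fst d)" "d \<in> set xs \<Longrightarrow> 0 < dart_sign d * walk_flow xs (fst d)"
proof -
  have eq: "a = d" if "a \<in> D" "fst a = fst d" for a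
    using that assms(1,3) orientationD[OF assms(1)] fst_eq_dart[of a d] by blast
  have "dart_sign d * walk_flow xs (fst d) = int (count_list xs d)"
    using assms(2)
  proof (induction xs)
    case (Cons a xs)
    then have "fst a = fst d \<longleftrightarrow> a = d" using eq[of a] by (metis insert_subset list.simps(15))
    then show ?case using Cons by (auto simp: distrib_left dart_sign_def)
  qed simp
  then show "0 \<le> dart_sign d * walk_flow xs (fst d)" "d \<in> set xs \<Longrightarrow> 0 < dart_sign d * walk_flow xs (fst d)"
    using count_list_0_iff[of xs d] by auto
qed

text \<open>
  The winding function of a closed directed walk never decreases when crossing an edge from right
  to left, and increases across the edges of the walk.
\<close>

lemma ex_face_height:
  assumes D: "orientation G D" and sc: "strongly_connected (digraph_of G D)"
  obtains h :: "complex set \<Rightarrow> int" where "\<And>d. d \<in> D \<Longrightarrow> h (rface d) < h (lface d)"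
proof -
  have sub: "D \<subseteq> darts" using orientationD(1)[OF D] .
  have fin: "finite D" using finite_subset[OF sub finite_darts] .
  have "\<exists>xs. set xs \<subseteq> D \<and> chain (tgt d) xs (src d)" if "d \<in> D" for d
  proof -
    have "d \<in> darts" using that sub by blast
    then show ?thesis using strongly_connected_imp_chain[OF sc tgt_in_vertices src_in_vertices] by metis
  qed
  then obtain w where w: "set (w d) \<subseteq> D" "chain (tgt d) (w d) (src d)" if "d \<in> D" for d by metis
  \<comment> \<open>The closed walk starts with \<open>d\<close> itself, which makes its winding
    function rise strictly across \<open>d\<close>; in the sum over all \<open>d\<close>, each dart
    thus has at least one positive term.\<close>
  define n where "n d = walk_flow (d # w d)" for d
  have wD: "set (d # w d) \<subseteq> D" if "d \<in> D" for d using that w(1) by simp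
  have n: "circulation (n d)" if "d \<in> D" for d
    unfolding circulation_def n_def
    using sum_walk_flow[of "d # w d" "src d" "src d"] wD[OF that] w(2)[OF that] sub by auto
  define h where "h f = (\<Sum>d\<in>D. face_winding (n d) f)" for f
  show thesis
  proof (rule that[of h])
    fix a assume a: "a \<in> D"
    have "h (lface a) - h (rface a) = (\<Sum>d\<in>D. dart_sign a * n d (fst a))"
      unfolding h_def sum_subtractf[symmetric] using n a sub by (intro sum.cong face_winding_jump) auto
    also have "\<dots> > 0"
    proof (rule sum_pos2[OF fin a])
      show "0 < dart_sign a * n a (fst a)"
        unfolding n_def by (rule walk_flow_nonneg(2)[OF D wD[OF a] a]) simp
      show "0 \<le> dart_sign a * n d (fst a)" if "d \<in> D" for d
        unfolding n_def by (rule walk_flow_nonneg(1)[OF D wD[OF that] a])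
    qed
    finally show "h (rface a) < h (lface a)" by simp
  qed
qed

section \<open>Flips\<close>

lemma winding_number_cyc:
  assumes "cyc C" "z \<notin> support C"
  shows "winding_number (walk_curve G C) z = (\<Sum>d\<leftarrow>C. winding_number (dart_curve G d) z)"
  using assms by (intro winding_number_walk_curve) (auto simp: cyc_def)

text \<open>Rotating the cycle so that it starts with \<open>d\<close> does not change its winding
  number around \<open>f\<close>, which is 1; hence \<open>f\<close> lies in the left region of a
  closed curve starting with \<open>d\<close>, while the right face of \<open>d\<close> misses that
  region.\<close>

lemma lface_ccw_cyc:
  assumes C: "cyc C" "ccw (walk_curve G C)" and f: "f \<in> faces G" "f = inside (support C)" and d: "d \<in> set C"
  shows "lface d = f"
proof (rule ccontr)
  assume not: "lface d \<noteq> f"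
  note c = cyc_curve[OF C(1)]
  have dd: "d \<in> darts" using C(1) d by (auto simp: cyc_def)
  have "frontier f = support C"
    using Jordan_inside_outside[OF c(1,2)] f(2) c(3) by simp
  then have "incident G f (fst d)" using d by (auto simp: incident_def)
  then have r: "f = rface d" using incident_iff[OF dd f(1)] not by blast
  obtain us vs where C_eq: "C = us @ d # vs" using d by (meson split_list)
  let ?C' = "d # vs @ us"
  have C': "cyc ?C'" using cyc_rotate[of us "d # vs"] C(1) by (simp add: C_eq)
  note c' = cyc_curve[OF C']
  have sup: "support ?C' = support C" by (auto simp: C_eq)
  obtain z where z: "z \<in> f" using f(1) in_components_nonempty unfolding faces_eq by blast
  then have zs: "z \<notin> support C" using f(2) inside_no_overlap[of "support C"] by blast
  have "winding_number (walk_curve G ?C') z = winding_number (walk_curve G C) z"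
    unfolding winding_number_cyc[OF C(1) zs] winding_number_cyc[OF C' zs[folded sup]]
    by (simp add: C_eq)
  also have "\<dots> = 1" using C(2) z f(2) c(3) unfolding ccw_def by simp
  finally have "z \<in> left_region (walk_curve G ?C')"
    using winding_number_left_region[OF c'(1,2), of z] zs unfolding c'(3) sup
    by (auto split: if_splits simp: of_bool_def)
  moreover have "rface d \<inter> left_region (walk_curve G ?C') = {}"
    using edge_lface_rface[OF dd C'] by metis
  ultimately show False using z r by blast
qed

text \<open>Reversing all darts negates the winding number, so a cycle that winds -1 times around
  its inside becomes counterclockwise.\<close>

lemma ccw_cyc_or_rev:
  assumes C: "cyc C"
  obtains C' where "cyc C'" "support C' = support C" "ccw (walk_curve G C')"
proof (cases "ccw (walk_curve G C)")
  case True
  then show thesis using that C by blast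
next
  case False
  let ?C' = "rev (map rev_dart C)"
  note c = cyc_curve[OF C] and C' = cyc_rev[OF C]
  note c' = cyc_curve[OF C']
  have sup: "support ?C' = support C" by auto
  have neg: "winding_number (walk_curve G C) z = -1" if "z \<in> inside (support C)" for z
    using simple_closed_path_winding_number_inside[OF c(1)] False c that unfolding ccw_def by metis
  have "winding_number (walk_curve G ?C') z = 1" if z: "z \<in> inside (support C)" for z
  proof -
    have zs: "z \<notin> support C" using z inside_no_overlap[of "support C"] by blast
    have "winding_number (dart_curve G (rev_dart d)) z = - winding_number (dart_curve G d) z" if "d \<in> set C" for d
      using that C zs path_dart[of d] by (auto simp: cyc_def intro!: winding_number_reversepath)
    then have "(\<Sum>d\<leftarrow>?C'. winding_number (dart_curve G d) z) = (\<Sum>d\<leftarrow>C. - winding_number (dart_curve G d) z)"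
      by (simp add: rev_map[symmetric] sum_list_rev o_def del: dart_curve_rev_dart cong: map_cong)
    also have "\<dots> = - (\<Sum>d\<leftarrow>C. winding_number (dart_curve G d) z)"
      by (induction C) simp_all
    finally show ?thesis
      using neg[OF z] unfolding winding_number_cyc[OF C zs] winding_number_cyc[OF C' zs[folded sup]]
      by simp
  qed
  then have "ccw (walk_curve G ?C')" using c' sup unfolding ccw_def by simp
  then show thesis using that[OF C' sup] by blast
qed

section \<open>Cycles of the library as cycles of darts\<close>

lemma cas_iff_chain: "pre_digraph.cas (digraph_of G D) u xs v \<longleftrightarrow> chain u xs v"
  by (induction xs arbitrary: u) (auto simp: pre_digraph.cas.simps digraph_of_def)

lemma awalk_verts_chain: "chain u xs v \<Longrightarrow> pre_digraph.awalk_verts (digraph_of G D) u xs = map src xs @ [v]"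
  by (induction xs arbitrary: u) (auto simp: pre_digraph.awalk_verts.simps digraph_of_def)

text \<open>The library's notion would admit a dart followed by its reverse. An orientation contains
  only one of the two, so the edges of its cycles are distinct, as \<open>cyc\<close>
  demands.\<close>

lemma cycle_iff_cyc:
  assumes D: "orientation G D"
  shows "pre_digraph.cycle (digraph_of G D) C \<longleftrightarrow> cyc C \<and> set C \<subseteq> D"
proof
  assume "pre_digraph.cycle (digraph_of G D) C"
  then obtain u where u: "set C \<subseteq> D" "chain u C u" "C \<noteq> []" "distinct (tl (map src C @ [u]))"
    unfolding pre_digraph.cycle_def pre_digraph.awalk_def cas_iff_chain
    by (auto simp: digraph_of_def awalk_verts_chain[where D = D, unfolded digraph_of_def])
  then have "src (hd C) = u" "distinct (map src C)" by (cases C; auto)+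
  moreover have "inj_on fst (set C)"
  proof (rule inj_onI)
    fix a b assume "a \<in> set C" "b \<in> set C" "fst a = fst b"
    then show "a = b" using u(1) orientationD[OF D] fst_eq_dart[of a b] by blast
  qed
  ultimately show "cyc C \<and> set C \<subseteq> D"
    using u orientationD(1)[OF D] by (auto simp: cyc_def distinct_map)
next
  assume C: "cyc C \<and> set C \<subseteq> D"
  then have ch: "chain (src (hd C)) C (src (hd C))" "C \<noteq> []" by (auto simp: cyc_def)
  have "hd C \<in> darts" using C by (cases C) (auto simp: cyc_def)
  then have "src (hd C) \<in> vertices G" by (rule src_in_vertices)
  moreover have "distinct (tl (map src C @ [src (hd C)]))" using C by (cases C) (auto simp: cyc_def)
  ultimately show "pre_digraph.cycle (digraph_of G D) C"
    using C ch unfolding pre_digraph.cycle_def pre_digraph.awalk_def cas_iff_chain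
    by (intro exI[of _ "src (hd C)"]) (simp add: awalk_verts_chain[OF ch(1)], simp add: digraph_of_def)
qed

text \<open>The effect of a flip without its cycle: the change of the orientation is the difference
  of the indicator of \<open>f\<close> across each edge. In this form it can be subtracted from a
  potential.\<close>

definition face_flip :: "complex set \<Rightarrow> 'e dart set \<Rightarrow> 'e dart set \<Rightarrow> bool" where
  "face_flip f D1 D2 \<longleftrightarrow> f \<in> faces G \<and> f \<noteq> outer_face G \<and> D2 \<subseteq> darts \<and>
     (\<forall>d\<in>darts. of_bool (d \<in> D1) - of_bool (d \<in> D2) = (of_bool (lface d = f) - of_bool (rface d = f) :: int))"

text \<open>\<open>f\<close> lies in one side of the cycle. That side is connected and misses the
  frontier of \<open>f\<close>, so it equals \<open>f\<close>; being bounded, it is the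
  inside.\<close>

lemma inner_face_eq_inside:
  assumes C: "cyc C" and f: "f \<in> faces G" "f \<noteq> outer_face G" "frontier f = support C"
  shows "f = inside (support C)"
proof -
  note c = cyc_curve[OF C]
  have "f \<inter> support C = {}"
    using face_disjoint_drawing[OF f(1)] support_subset_drawing[of C] C by (auto simp: cyc_def)
  moreover have fc: "connected f" "f \<noteq> {}" using f(1) in_components_connected in_components_nonempty unfolding faces_eq by blast+
  ultimately obtain S where S: "S \<in> components (- support C)" "f \<subseteq> S"
    using exists_component_superset[of f "- support C"] by blast
  have "S \<inter> frontier f = {}" using in_components_subset[OF S(1)] f(3) by blast
  then have "f = S"
    using connected_Int_frontier[of S f] in_components_connected[OF S(1)] S(2) fc(2) by blast
  moreover have "S \<noteq> outside (support C)"
    using \<open>f = S\<close> unbounded_face_iff[OF f(1)] f(2) Jordan_inside_outside[OF c(1,2)] c(3) by auto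
  ultimately show ?thesis using S(1) components_Compl_Jordan[OF c(1,2)] c(3) by auto
qed

text \<open>The darts with \<open>f\<close> on their left are exactly those of \<open>C\<close>:
  such a dart runs along the frontier of \<open>f\<close>, so it or its reverse is in
  \<open>C\<close>, and in the latter case \<open>f\<close> would be on both of its sides.\<close>

lemma face_flip_cyc:
  assumes D1: "orientation G D1" and C: "cyc C" "set C \<subseteq> D1" "ccw (walk_curve G C)"
    and f: "f \<in> faces G" "f \<noteq> outer_face G" "frontier f = support C"
  shows "face_flip f D1 ((D1 - set C) \<union> rev_dart ` set C)"
proof -
  note fi = inner_face_eq_inside[OF C(1) f]
  have lf: "lface d = f" if "d \<in> set C" for d using lface_ccw_cyc[OF C(1,3) f(1) fi that] .
  have iff: "lface d = f \<longleftrightarrow> d \<in> set C" if d: "d \<in> darts" for d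
  proof
    assume l: "lface d = f"
    then have "img d \<subseteq> support C" using incident_iff[OF d f(1)] f(3) by (simp add: incident_def)
    moreover obtain x where x: "x \<in> open_edge d" using open_edge_eq[OF d] by fastforce
    ultimately obtain d' where d': "d' \<in> set C" "x \<in> img d'" by (auto simp: open_edge_def)
    then have "d' \<in> darts" using C(1) by (auto simp: cyc_def)
    then have "fst d' = fst d" using open_edge_disjoint(2)[OF d] x d'(2) by blast
    then consider "d' = d" | "d' = rev_dart d" using fst_eq_dart by blast
    then show "d \<in> set C"
    proof cases
      case 2
      then show ?thesis using lf[OF d'(1)] l lface_neq_rface[OF d] by simp
    qed (use d' in simp)
  qed (rule lf)
  have rev_mem: "d \<in> rev_dart ` set C \<longleftrightarrow> rev_dart d \<in> set C" for d
    by (metis image_eqI imageE rev_dart_rev_dart)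
  have "of_bool (d \<in> D1) - of_bool (d \<in> (D1 - set C) \<union> rev_dart ` set C) =
      (of_bool (lface d = f) - of_bool (rface d = f) :: int)" if d: "d \<in> darts" for d
    using iff[OF d] iff[of "rev_dart d"] d lface_neq_rface[OF d] C(2) orientationD(2)[OF D1 d] rev_mem[of d]
    by auto
  moreover have "(D1 - set C) \<union> rev_dart ` set C \<subseteq> darts"
    using orientationD(1)[OF D1] C(2) by auto
  ultimately show ?thesis using f by (simp add: face_flip_def)
qed

lemma flip_imp_face_flip:
  assumes "orientation G D1" "flip G D1 D2"
  obtains f where "face_flip f D1 D2"
proof -
  obtain f C where f: "f \<in> faces G" "f \<noteq> outer_face G" and C: "pre_digraph.cycle (digraph_of G D1) C"
    "path_image (walk_curve G C) = frontier f" "ccw (walk_curve G C)"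
    and D2: "D2 = (D1 - set C) \<union> rev_dart ` set C"
    using assms(2) unfolding flip_def by blast
  have "cyc C" "set C \<subseteq> D1" using C(1) cycle_iff_cyc[OF assms(1)] by auto
  then show thesis
    using that face_flip_cyc[OF assms(1) _ _ C(3) f] C(2) cyc_curve(3)[of C] D2 by auto
qed

text \<open>For the two directions of an edge the right-hand sides of the flip equations cancel, so
  the number of selected directions remains 1.\<close>

lemma orientation_face_flip:
  assumes "orientation G D1" "face_flip f D1 D2"
  shows "orientation G D2"
proof -
  have "(e, True) \<in> D2 \<longleftrightarrow> (e, False) \<notin> D2" if e: "e \<in> edges G" for e
  proof -
    have d: "(e, True) \<in> darts" "(e, False) \<in> darts" using e by auto
    have r: "rev_dart (e, True) = (e, False)" "rev_dart (e, False) = (e, True)" by (auto simp: rev_dart_def)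
    have "(e, True) \<in> D1 \<longleftrightarrow> (e, False) \<notin> D1" using assms(1) e by (simp add: orientation_def)
    then have "of_bool ((e, True) \<in> D1) + of_bool ((e, False) \<in> D1) = (1 :: int)"
      by (cases "(e, True) \<in> D1") auto
    moreover have "of_bool (d \<in> D1) - of_bool (d \<in> D2) = (of_bool (lface d = f) - of_bool (rface d = f) :: int)"
      if "d \<in> darts" for d using assms(2) that unfolding face_flip_def by blast
    note this[OF d(1), unfolded r] this[OF d(2), unfolded r]
    ultimately have "of_bool ((e, True) \<in> D2) + of_bool ((e, False) \<in> D2) = (1 :: int)" by linarith
    then show ?thesis by (cases "(e, True) \<in> D2"; cases "(e, False) \<in> D2") simp_all
  qed
  then show ?thesis using assms(2) by (auto simp: orientation_def face_flip_def darts_def)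
qed

text \<open>Subtracting the indicator of \<open>f\<close> changes the jumps exactly as the flip
  changes the orientation. The normalisation survives because \<open>f\<close> is not the outer
  face.\<close>

lemma difference_potential_face_flip:
  assumes "face_flip f D1 D2"
  shows "difference_potential D1 D z \<longleftrightarrow> difference_potential D2 D (\<lambda>g. z g - of_bool (g = f))"
proof -
  have "z (lface d) - z (rface d) = of_bool (d \<in> D1) - of_bool (d \<in> D) \<longleftrightarrow>
    (z (lface d) - of_bool (lface d = f)) - (z (rface d) - of_bool (rface d = f)) = of_bool (d \<in> D2) - of_bool (d \<in> D)"
    if "d \<in> darts" for d
  proof -
    have "of_bool (d \<in> D1) - of_bool (d \<in> D2) = (of_bool (lface d = f) - of_bool (rface d = f) :: int)"
      using assms that by (simp add: face_flip_def)
    then show ?thesis by linarith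
  qed
  then have ball_eq: "(\<forall>d\<in>darts. z (lface d) - z (rface d) = of_bool (d \<in> D1) - of_bool (d \<in> D)) \<longleftrightarrow>
    (\<forall>d\<in>darts. (z (lface d) - of_bool (lface d = f)) - (z (rface d) - of_bool (rface d = f)) = of_bool (d \<in> D2) - of_bool (d \<in> D))"
    by blast
  have "outer_face G \<noteq> f" using assms unfolding face_flip_def by blast
  then have "z (outer_face G) - of_bool (outer_face G = f) = z (outer_face G)" by simp
  then show ?thesis
    unfolding difference_potential_def by (simp only: ball_eq)
qed

text \<open>The first flip contributes the indicator of its face to the potential of the remaining
  sequence, which keeps it non-negative and raises its sum by exactly 1.\<close>

lemma flips_imp_potential:
  assumes "(flip G ^^ n) D' D" "orientation G D'"
  shows "\<exists>z. difference_potential D' D z \<and> (\<forall>f\<in>faces G. 0 \<le> z f) \<and> (\<Sum>f\<in>faces G. z f) = int n"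
  using assms
proof (induction n arbitrary: D')
  case 0
  then show ?case by (intro exI[of _ "\<lambda>_. 0"]) (simp add: difference_potential_def)
next
  case (Suc n)
  obtain D2 where D2: "flip G D' D2" "(flip G ^^ n) D2 D" using Suc.prems(1) by (metis relpowp_Suc_D2)
  obtain f where f: "face_flip f D' D2" using flip_imp_face_flip[OF Suc.prems(2) D2(1)] .
  obtain z where z: "difference_potential D2 D z" "\<forall>f\<in>faces G. 0 \<le> z f" "(\<Sum>f\<in>faces G. z f) = int n"
    using Suc.IH[OF D2(2) orientation_face_flip[OF Suc.prems(2) f]] by blast
  let ?z = "\<lambda>g. z g + of_bool (g = f)"
  have "difference_potential D' D ?z"
    using z(1) unfolding difference_potential_face_flip[OF f] by simp
  moreover have "(\<Sum>g\<in>faces G. ?z g) = int (Suc n)"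
    using z(3) f finite_faces by (simp add: sum.distrib face_flip_def of_bool_def)
  ultimately show ?case using z(2) by (intro exI[of _ ?z]) auto
qed

text \<open>
  Among the faces of positive potential, one of maximal height has all its boundary edges directed
  counterclockwise.
\<close>

lemma ex_flip:
  assumes D': "orientation G D'" and D: "orientation G D"
    and z: "difference_potential D' D z" and pos: "f0 \<in> faces G" "0 < z f0"
    and h: "\<And>d. d \<in> D' \<Longrightarrow> h (rface d) < (h (lface d) :: int)"
  obtains f D2 where "flip G D' D2" "face_flip f D' D2" "0 < z f"
proof -
  define A where "A = {f \<in> faces G. 0 < z f}"
  have "finite A" "A \<noteq> {}" using finite_faces pos by (auto simp: A_def)
  then have "Max (h ` A) \<in> h ` A" by (intro Max_in) auto
  then obtain f where "f \<in> A" "h f = Max (h ` A)" by (metis imageE)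
  then have f: "f \<in> A" "\<And>g. g \<in> A \<Longrightarrow> h g \<le> h f" using \<open>finite A\<close> by auto
  have fF: "f \<in> faces G" "0 < z f" using f(1) by (auto simp: A_def)
  have fo: "f \<noteq> outer_face G" using fF z by (auto simp: difference_potential_def)
  have sink: "d \<notin> D'" if d: "d \<in> darts" "rface d = f" for d
  proof
    assume dD: "d \<in> D'"
    \<comment> \<open>Across such an edge the potential would be at least \<open>z f\<close>, so the
      face on the other side would belong to \<open>A\<close> and be higher than
      \<open>f\<close>.\<close>
    then have "z (lface d) - z f = 1 - of_bool (d \<in> D)" using z d by (auto simp: difference_potential_def)
    then have "0 < z (lface d)" using fF by (cases "d \<in> D") auto
    then have "h (lface d) \<le> h f" using f(2) lface_in_faces[OF d(1)] by (simp add: A_def)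
    then show False using h[OF dD] d by simp
  qed
  obtain C0 where C0: "cyc C0" "f \<in> components (- support C0)" using face_bounded_by_cyc[OF fF(1)] .
  obtain C where C: "cyc C" "support C = support C0" "ccw (walk_curve G C)" using ccw_cyc_or_rev[OF C0(1)] .
  have fr: "frontier f = support C"
    using frontier_component_cyc[OF C0] C(2) by simp
  note fi = inner_face_eq_inside[OF C(1) fF(1) fo fr]
  have CD: "set C \<subseteq> D'"
  proof
    fix d assume d: "d \<in> set C"
    then have dd: "d \<in> darts" using C(1) by (auto simp: cyc_def)
    \<comment> \<open>The reverse of a dart of the counterclockwise cycle has \<open>f\<close> on
      its right, so \<open>sink\<close> keeps it out of \<open>D'\<close> and the dart itself is
      selected.\<close>
    have "rface (rev_dart d) = f" using lface_ccw_cyc[OF C(1,3) fF(1) fi d] by simp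
    then have "rev_dart d \<notin> D'" using sink[of "rev_dart d"] dd by simp
    then show "d \<in> D'" using orientationD(2)[OF D' dd] by blast
  qed
  let ?D2 = "(D' - set C) \<union> rev_dart ` set C"
  have "pre_digraph.cycle (digraph_of G D') C" using C(1) CD cycle_iff_cyc[OF D'] by blast
  moreover have "path_image (walk_curve G C) = frontier f" using fr cyc_curve(3)[OF C(1)] by simp
  moreover have "f \<in> faces G - {outer_face G}" using fF(1) fo by blast
  ultimately have "flip G D' ?D2" unfolding flip_def using C(3) by blast
  then show thesis using that face_flip_cyc[OF D' C(1) CD C(3) fF(1) fo fr] fF(2) by blast
qed

text \<open>After the flip no selected dart has \<open>f\<close> on its left, so lowering
  \<open>f\<close> cannot violate the inequality; a selected dart that does not have
  \<open>f\<close> on its right was already selected before.\<close>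

lemma face_height_face_flip:
  fixes h :: "complex set \<Rightarrow> int"
  assumes D1: "orientation G D1" and flip: "face_flip f D1 D2"
    and h: "\<And>d. d \<in> D1 \<Longrightarrow> h (rface d) < h (lface d)"
  obtains h' :: "complex set \<Rightarrow> int" where "\<And>d. d \<in> D2 \<Longrightarrow> h' (rface d) < h' (lface d)"
proof
  fix d assume d: "d \<in> D2"
  have dd: "d \<in> darts" using d flip unfolding face_flip_def by blast
  then have eq: "of_bool (d \<in> D1) - of_bool (d \<in> D2) = (of_bool (lface d = f) - of_bool (rface d = f) :: int)"
    using flip unfolding face_flip_def by blast
  have nl: "lface d \<noteq> f"
  proof
    assume "lface d = f"
    then show False using eq d lface_neq_rface[OF dd] by (cases "d \<in> D1") simp_all
  qed
  have "Min (h ` faces G) \<le> h (lface d)" using finite_faces lface_in_faces[OF dd] by simp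
  moreover have "d \<in> D1" if "rface d \<noteq> f" using eq d nl that by (cases "d \<in> D1") simp_all
  \<comment> \<open>The new value at \<open>f\<close> lies strictly below all old heights, which
    settles every dart with \<open>f\<close> on its right.\<close>
  ultimately show "(h(f := Min (h ` faces G) - 1)) (rface d) < (h(f := Min (h ` faces G) - 1)) (lface d)"
    using nl h[of d] by auto
qed

text \<open>Induction on the total potential, with \<open>z\<close> and \<open>h\<close> generalised
  because each flip replaces both. The flipped face has positive potential, so subtracting 1 there
  keeps the potential non-negative.\<close>

lemma potential_imp_flips:
  assumes "orientation G D'" "orientation G D" "difference_potential D' D z"
    "\<forall>f\<in>faces G. 0 \<le> z f" "(\<Sum>f\<in>faces G. z f) = int n"
    and "\<And>d. d \<in> D' \<Longrightarrow> h (rface d) < (h (lface d) :: int)"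
  shows "(flip G ^^ n) D' D"
  using assms
proof (induction n arbitrary: D' z h)
  case 0
  then have "\<forall>f\<in>faces G. z f = 0" using finite_faces by (simp add: sum_nonneg_eq_0_iff)
  then have "of_bool (d \<in> D') = (of_bool (d \<in> D) :: int)" if "d \<in> darts" for d
    using 0(3) that lface_in_faces[OF that] rface_in_faces[OF that] by (auto simp: difference_potential_def)
  then have "d \<in> D' \<longleftrightarrow> d \<in> D" if "d \<in> darts" for d using that by (metis of_bool_eq_iff)
  then have "D' = D" using orientationD(1)[OF 0(1)] orientationD(1)[OF 0(2)] by blast
  then show ?case by simp
next
  case (Suc n)
  have "\<exists>f0\<in>faces G. 0 < z f0"
  proof (rule ccontr)
    assume "\<not> ?thesis"
    then have "(\<Sum>f\<in>faces G. z f) \<le> 0" by (intro sum_nonpos) (auto simp: not_less)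
    then show False using Suc.prems(5) by simp
  qed
  then obtain f D2 where f: "flip G D' D2" "face_flip f D' D2" "0 < z f"
    using ex_flip[OF Suc.prems(1-3) _ _ Suc.prems(6)] by blast
  obtain h' :: "complex set \<Rightarrow> int" where h': "\<And>d. d \<in> D2 \<Longrightarrow> h' (rface d) < h' (lface d)"
    using face_height_face_flip[OF Suc.prems(1) f(2) Suc.prems(6)] by blast
  let ?z = "\<lambda>g. z g - of_bool (g = f)"
  have "(flip G ^^ n) D2 D"
  proof (rule Suc.IH[OF orientation_face_flip[OF Suc.prems(1) f(2)] Suc.prems(2) _ _ _ h'])
    show "difference_potential D2 D ?z" using Suc.prems(3) difference_potential_face_flip[OF f(2)] by blast
    show "\<forall>g\<in>faces G. 0 \<le> ?z g" using Suc.prems(4) f(3) by auto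
    show "(\<Sum>g\<in>faces G. ?z g) = int n"
      using Suc.prems(5) f(2) finite_faces by (simp add: sum_subtractf face_flip_def of_bool_def)
  qed
  then show ?case using f(1) by (metis relpowp_Suc_I2)
qed

end

theorem theorem3p2:
  fixes G :: "'e plane_drawing" and \<alpha> :: "complex \<Rightarrow> nat" and D D' :: "'e dart set"
  assumes "plane_graph G" and "two_connected G"
    and "alpha_orientation G \<alpha> D" and "strongly_connected (digraph_of G D)"
    and "alpha_orientation G \<alpha> D'" and "strongly_connected (digraph_of G D')"
  shows "(flip_le G D D' \<longleftrightarrow> (\<forall>f\<in>faces G. 0 \<le> potential G (D' - D) f)) \<and>
         (flip_le G D D' \<longrightarrow>
            int (flip_distance G D' D) = (\<Sum>f\<in>faces G. potential G (D' - D) f))"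
proof -
  interpret two_connected_plane_graph G
    using assms(1,2) by unfold_locales
  have o: "orientation G D" "orientation G D'" using assms by (auto simp: alpha_orientation_def)
  obtain z where z: "difference_potential D' D z"
    using ex_difference_potential[OF assms(5,3)] by blast
  have pot: "potential G (D' - D) f = z f" if "f \<in> faces G" for f
    using potential_eq[OF o(2,1) z that] .
  \<comment> \<open>The potential is unique, so every flip sequence from \<open>D'\<close> to
    \<open>D\<close> yields the same \<open>z\<close>. All of them have the same length, in
    particular the shortest one.\<close>
  have steps: "(\<forall>f\<in>faces G. 0 \<le> z f) \<and> (\<Sum>f\<in>faces G. z f) = int n" if n: "(flip G ^^ n) D' D" for n
  proof -
    obtain z' where z': "difference_potential D' D z'" "\<forall>f\<in>faces G. 0 \<le> z' f" "(\<Sum>f\<in>faces G. z' f) = int n"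
      using flips_imp_potential[OF n o(2)] by blast
    have "z f = z' f" if "f \<in> faces G" for f using difference_potential_unique[OF z z'(1) that] .
    then show ?thesis using z' by simp
  qed
  obtain h :: "complex set \<Rightarrow> int" where h: "\<And>d. d \<in> D' \<Longrightarrow> h (rface d) < h (lface d)"
    using ex_face_height[OF o(2) assms(6)] by blast
  have "flip_le G D D' \<longleftrightarrow> (\<exists>n. (flip G ^^ n) D' D)"
    unfolding flip_le_def by (simp add: rtranclp_power)
  moreover have "\<exists>n. (flip G ^^ n) D' D" if nn: "\<forall>f\<in>faces G. 0 \<le> z f"
  proof -
    have "(\<Sum>f\<in>faces G. z f) = int (nat (\<Sum>f\<in>faces G. z f))" using nn by (simp add: sum_nonneg)
    then show ?thesis using potential_imp_flips[OF o(2,1) z nn _ h] by blast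
  qed
  moreover have "int (flip_distance G D' D) = (\<Sum>f\<in>faces G. z f)" if "\<exists>n. (flip G ^^ n) D' D"
    using steps[OF LeastI_ex[OF that]] by (simp add: flip_distance_def)
  ultimately show ?thesis using steps pot by auto
qed

end
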